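(* Let $\overline{\mathbf B}$ be the topological quotient of $\mathbf B$ by the equivalence relation $X \sim Y$ iff $W_{\mathfrak g}X = W_{\mathfrak g}Y$ (diagonal action on $\mathfrak t^p$), and $\overline Q$ the class of $Q$. Let $W_{\mathfrak g\mid\boldsymbol{\mathfrak h}} = \operatorname{Stab}_{W_{\mathfrak g}}(\mathbf U)/W_{\mathfrak h_1}$. Then the projection $\mathbf B \to \overline{\mathbf B}$ is a Galois covering, and $\pi_1(\overline{\mathbf B},\overline Q)$ is an extension of $W_{\mathfrak g\mid\boldsymbol{\mathfrak h}}$ by $\pi_1(\mathbf B,Q)$ (i.e. there is a short exact sequence $1\to\pi_1(\mathbf B,Q)\to\pi_1(\overline{\mathbf B},\overline Q)\to W_{\mathfrak g\mid\boldsymbol{\mathfrak h}}\to 1$).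
   Context: $G$ is a connected complex reductive Lie group, $\mathfrak g = \mathrm{Lie}(G)$, $T\subseteq G$ a maximal torus, $\mathfrak t = \mathrm{Lie}(T)$, $\Phi_{\mathfrak g}$ the root system of $(\mathfrak g,\mathfrak t)$, $W_{\mathfrak g}$ the Weyl group acting on $\mathfrak t$. Fix $p\geq 1$, $A_1,\dots,A_p\in\mathfrak t$, and the irregular type $Q = \sum_{i=1}^p A_i z^{-i}$, identified with $(A_1,\dots,A_p)\in\mathfrak t^p$, on which $W_{\mathfrak g}$ acts diagonally. For $\alpha\in\Phi_{\mathfrak g}$ let $d_\alpha = \max\{i:\alpha(A_i)\ne0\}$ ($0$ if none). For $i\in\{1,\dots,p\}$: $\Phi_{\mathfrak h_i}=\{\alpha: d_\alpha<i\}$ (roots of the centraliser $\mathfrak h_i$ of $\{A_i,\dots,A_p\}$), $U_i=\bigcap_{\alpha\in\Phi_{\mathfrak h_i}}\ker\alpha$ ($=\mathfrak t$ if empty), and $\mathbf B_i=\{X\in\mathfrak t: \alpha(X)=0 \text{ if } d_\alpha<i,\ \alpha(X)\ne0\text{ if } d_\alpha=i\}$; $\mathbf B=\mathbf B_1\times\dots\times\mathbf B_p\subseteq\mathfrak t^p$. $\operatorname{Stab}_{W_{\mathfrak g}}(\mathbf U)=\bigcap_{i=1}^p\{w\in W_{\mathfrak g}: w(U_i)\subseteq U_i\}$ is the setwise stabiliser of the flag $\mathbf U = (\mathfrak t\supseteq U_1\supseteq\dots\supseteq U_p)$, and $W_{\mathfrak h_1}$, the Weyl group of $\Phi_{\mathfrak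 h_1}$ (generated by reflections in its roots), is a normal subgroup of it. *)

theory Defs
  imports "HOL-Analysis.Analysis" "HOL-Algebra.Coset"
begin

text \<open>The Cartan subalgebra t is modelled as complex^'n.  Roots are complex-linear
  functionals on t; each root alpha has a coroot cor alpha in t.  A reduced root datum
  (tensored with C) is exactly what a connected complex reductive group with a maximal
  torus determines on the level of (t, roots, coroots).\<close>

definition clin_fun :: "(complex^'n \<Rightarrow> complex) \<Rightarrow> bool" where
  "clin_fun f \<longleftrightarrow> (\<forall>x y. f (x + y) = f x + f y) \<and> (\<forall>c x. f (c *s x) = c * f x)"

definition rrefl :: "(complex^'n \<Rightarrow> complex) \<Rightarrow> complex^'n \<Rightarrow> complex^'n \<Rightarrow> complex^'n" where
  "rrefl \<alpha> h X = X - (\<alpha> X) *s h"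

definition reduced_root_datum ::
  "(complex^'n \<Rightarrow> complex) set \<Rightarrow> ((complex^'n \<Rightarrow> complex) \<Rightarrow> complex^'n) \<Rightarrow> bool" where
  "reduced_root_datum \<Phi> cor \<longleftrightarrow>
     finite \<Phi> \<and>
     (\<forall>\<alpha>\<in>\<Phi>. clin_fun \<alpha>) \<and>
     (\<forall>\<alpha>\<in>\<Phi>. \<alpha> (cor \<alpha>) = 2) \<and>
     (\<forall>\<alpha>\<in>\<Phi>. \<forall>\<beta>\<in>\<Phi>. \<beta> (cor \<alpha>) \<in> \<int>) \<and>
     (\<forall>\<alpha>\<in>\<Phi>. \<forall>\<beta>\<in>\<Phi>. \<beta> \<circ> rrefl \<alpha> (cor \<alpha>) \<in> \<Phi>) \<and>
     (\<forall>\<alpha>\<in>\<Phi>. \<forall>\<beta>\<in>\<Phi>. cor (\<beta> \<circ> rrefl \<alpha> (cor \<alpha>)) = rrefl \<alpha> (cor \<alpha>) (cor \<beta>)) \<and>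
     (\<forall>\<alpha>\<in>\<Phi>. \<forall>c::complex. (\<lambda>X. c * \<alpha> X) \<in> \<Phi> \<longrightarrow> c = 1 \<or> c = -1)"

inductive_set weyl_group ::
  "(complex^'n \<Rightarrow> complex) set \<Rightarrow> ((complex^'n \<Rightarrow> complex) \<Rightarrow> complex^'n)
   \<Rightarrow> (complex^'n \<Rightarrow> complex^'n) set"
  for \<Psi> cor where
  weyl_id: "id \<in> weyl_group \<Psi> cor"
| weyl_step: "w \<in> weyl_group \<Psi> cor \<Longrightarrow> \<alpha> \<in> \<Psi> \<Longrightarrow> rrefl \<alpha> (cor \<alpha>) \<circ> w \<in> weyl_group \<Psi> cor"

definition weyl_grp :: "(complex^'n \<Rightarrow> complex) set \<Rightarrow> ((complex^'n \<Rightarrow> complex) \<Rightarrow> complex^'n)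
   \<Rightarrow> (complex^'n \<Rightarrow> complex^'n) monoid" where
  "weyl_grp \<Psi> cor = \<lparr>carrier = weyl_group \<Psi> cor, mult = (\<circ>), one = id\<rparr>"

text \<open>Points of t^p are functions in {1..p} ->E t (extensional).\<close>

definition dgr :: "nat \<Rightarrow> (nat \<Rightarrow> complex^'n) \<Rightarrow> (complex^'n \<Rightarrow> complex) \<Rightarrow> nat" where
  "dgr p A \<alpha> = (if \<exists>i\<in>{1..p}. \<alpha> (A i) \<noteq> 0 then Max {i\<in>{1..p}. \<alpha> (A i) \<noteq> 0} else 0)"

definition Phi_h :: "(complex^'n \<Rightarrow> complex) set \<Rightarrow> nat \<Rightarrow> (nat \<Rightarrow> complex^'n) \<Rightarrow> nat
   \<Rightarrow> (complex^'n \<Rightarrow> complex) set" where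
  "Phi_h \<Phi> p A i = {\<alpha>\<in>\<Phi>. dgr p A \<alpha> < i}"

definition Usp :: "(complex^'n \<Rightarrow> complex) set \<Rightarrow> nat \<Rightarrow> (nat \<Rightarrow> complex^'n) \<Rightarrow> nat
   \<Rightarrow> (complex^'n) set" where
  "Usp \<Phi> p A i = {X. \<forall>\<alpha>\<in>Phi_h \<Phi> p A i. \<alpha> X = 0}"

definition Bsp :: "(complex^'n \<Rightarrow> complex) set \<Rightarrow> nat \<Rightarrow> (nat \<Rightarrow> complex^'n) \<Rightarrow> nat
   \<Rightarrow> (complex^'n) set" where
  "Bsp \<Phi> p A i = {X. (\<forall>\<alpha>\<in>\<Phi>. dgr p A \<alpha> < i \<longrightarrow> \<alpha> X = 0) \<and>
                        (\<forall>\<alpha>\<in>\<Phi>. dgr p A \<alpha> = i \<longrightarrow> \<alpha> X \<noteq> 0)}"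

definition Bfull :: "(complex^'n \<Rightarrow> complex) set \<Rightarrow> nat \<Rightarrow> (nat \<Rightarrow> complex^'n)
   \<Rightarrow> (nat \<Rightarrow> complex^'n) set" where
  "Bfull \<Phi> p A = PiE {1..p} (Bsp \<Phi> p A)"

definition tp_top :: "nat \<Rightarrow> (nat \<Rightarrow> complex^'n) topology" where
  "tp_top p = product_topology (\<lambda>i. euclidean) {1..p}"

definition Btop :: "(complex^'n \<Rightarrow> complex) set \<Rightarrow> nat \<Rightarrow> (nat \<Rightarrow> complex^'n)
   \<Rightarrow> (nat \<Rightarrow> complex^'n) topology" where
  "Btop \<Phi> p A = subtopology (tp_top p) (Bfull \<Phi> p A)"

definition dact :: "nat \<Rightarrow> (complex^'n \<Rightarrow> complex^'n) \<Rightarrow> (nat \<Rightarrow> complex^'n) \<Rightarrow> (nat \<Rightarrow> complex^'n)" where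
  "dact p w X = restrict (\<lambda>i. w (X i)) {1..p}"

definition worbit :: "(complex^'n \<Rightarrow> complex^'n) set \<Rightarrow> nat \<Rightarrow> (nat \<Rightarrow> complex^'n)
   \<Rightarrow> (nat \<Rightarrow> complex^'n) set" where
  "worbit W p X = (\<lambda>w. dact p w X) ` W"

definition Stab_U :: "(complex^'n \<Rightarrow> complex) set \<Rightarrow> ((complex^'n \<Rightarrow> complex) \<Rightarrow> complex^'n)
   \<Rightarrow> nat \<Rightarrow> (nat \<Rightarrow> complex^'n) \<Rightarrow> (complex^'n \<Rightarrow> complex^'n) set" where
  "Stab_U \<Phi> cor p A = {w\<in>weyl_group \<Phi> cor. \<forall>i\<in>{1..p}. w ` Usp \<Phi> p A i \<subseteq> Usp \<Phi> p A i}"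

definition W_gh :: "(complex^'n \<Rightarrow> complex) set \<Rightarrow> ((complex^'n \<Rightarrow> complex) \<Rightarrow> complex^'n)
   \<Rightarrow> nat \<Rightarrow> (nat \<Rightarrow> complex^'n) \<Rightarrow> (complex^'n \<Rightarrow> complex^'n) set monoid" where
  "W_gh \<Phi> cor p A =
     ((weyl_grp \<Phi> cor)\<lparr>carrier := Stab_U \<Phi> cor p A\<rparr>) Mod (weyl_group (Phi_h \<Phi> p A 1) cor)"

definition quotient_top :: "'a topology \<Rightarrow> ('a \<Rightarrow> 'b) \<Rightarrow> 'b topology" where
  "quotient_top X f = topology (\<lambda>U. U \<subseteq> f ` topspace X \<and> openin X {x\<in>topspace X. f x \<in> U})"

definition covering_map :: "'a topology \<Rightarrow> 'b topology \<Rightarrow> ('a \<Rightarrow> 'b) \<Rightarrow> bool" where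
  "covering_map E Y f \<longleftrightarrow>
     continuous_map E Y f \<and> f ` topspace E = topspace Y \<and>
     (\<forall>y\<in>topspace Y. \<exists>T. y \<in> T \<and> openin Y T \<and>
        (\<exists>v. \<Union>v = {x\<in>topspace E. f x \<in> T} \<and> (\<forall>u\<in>v. openin E u) \<and> pairwise disjnt v \<and>
             (\<forall>u\<in>v. homeomorphic_map (subtopology E u) (subtopology Y T) f)))"

definition galois_covering :: "'a topology \<Rightarrow> 'b topology \<Rightarrow> ('a \<Rightarrow> 'b) \<Rightarrow> bool" where
  "galois_covering E Y f \<longleftrightarrow>
     covering_map E Y f \<and> connected_space E \<and>
     (\<forall>x\<in>topspace E. \<forall>x'\<in>topspace E. f x = f x' \<longrightarrow>
        (\<exists>h. homeomorphic_map E E h \<and> (\<forall>z\<in>topspace E. f (h z) = f z) \<and> h x = x'))"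

definition loops_at :: "'a topology \<Rightarrow> 'a \<Rightarrow> (real \<Rightarrow> 'a) set" where
  "loops_at X x = {g. pathin X g \<and> g 0 = x \<and> g 1 = x}"

definition loop_homotopic :: "'a topology \<Rightarrow> 'a \<Rightarrow> (real \<Rightarrow> 'a) \<Rightarrow> (real \<Rightarrow> 'a) \<Rightarrow> bool" where
  "loop_homotopic X x g h \<longleftrightarrow>
     (\<exists>H. continuous_map (prod_topology (top_of_set {0..1::real}) (top_of_set {0..1::real})) X H \<and>
          (\<forall>t\<in>{0..1}. H (0, t) = g t \<and> H (1, t) = h t) \<and>
          (\<forall>s\<in>{0..1}. H (s, 0) = x \<and> H (s, 1) = x))"

definition loop_class :: "'a topology \<Rightarrow> 'a \<Rightarrow> (real \<Rightarrow> 'a) \<Rightarrow> (real \<Rightarrow> 'a) set" where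
  "loop_class X x g = {h\<in>loops_at X x. loop_homotopic X x g h}"

definition loop_join :: "(real \<Rightarrow> 'a) \<Rightarrow> (real \<Rightarrow> 'a) \<Rightarrow> real \<Rightarrow> 'a" where
  "loop_join g h = (\<lambda>t. if t \<le> 1/2 then g (2 * t) else h (2 * t - 1))"

definition fundamental_group :: "'a topology \<Rightarrow> 'a \<Rightarrow> (real \<Rightarrow> 'a) set monoid" where
  "fundamental_group X x =
     \<lparr>carrier = loop_class X x ` loops_at X x,
      mult = (\<lambda>C D. loop_class X x (loop_join (SOME g. g \<in> C) (SOME h. h \<in> D))),
      one = loop_class X x (\<lambda>t. x)\<rparr>"

definition short_exact :: "('a, 'm) monoid_scheme \<Rightarrow> ('b, 'n) monoid_scheme \<Rightarrow> ('c, 'o) monoid_scheme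
   \<Rightarrow> ('a \<Rightarrow> 'b) \<Rightarrow> ('b \<Rightarrow> 'c) \<Rightarrow> bool" where
  "short_exact K G H f g \<longleftrightarrow>
     f \<in> hom K G \<and> g \<in> hom G H \<and> inj_on f (carrier K) \<and> g ` carrier G = carrier H \<and>
     f ` carrier K = kernel G H g"

end

theory Submission
  imports Defs
begin

text \<open>The points of \<open>B\<close> are exactly the tuples with the same degrees \<open>d\<^sub>\<alpha>\<close> as \<open>A\<close>, and a Weyl group
  element stabilises the flag iff it preserves these degrees. Hence two points of \<open>B\<close> lie in one
  Weyl orbit iff they lie in one orbit of the flag stabiliser, which acts on \<open>B\<close>. By the theorem
  that the pointwise stabiliser of a set in a Weyl group is generated by the reflections it contains
  (it follows from the exchange property, for a positive system with \<open>Re \<alpha>(Z) \<ge> 0\<close> on positive roots, where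
  \<open>Z\<close> is a generic combination of the given points), the stabiliser of any point of \<open>B\<close> is the Weyl group
  of \<open>h\<^sub>1\<close>, which fixes all of \<open>B\<close>. So a finite quotient group acts freely on a Hausdorff
  space, and the projection is a covering. The space is path connected because a complex line through
  two of its points meets the removed hyperplanes in finitely many points; lifting loops and
  homotopies then gives the exact sequence.\<close>

section \<open>Pointwise stabilisers in Weyl groups\<close>

text \<open>The datum gives no inner product and no finiteness of the Weyl group, and the roots need
  not span the dual of t. Positivity is therefore read off from real parts of root values at a
  vector, a sum over coroots serves as the invariant form, and finiteness of W is itself a
  consequence of the fixator argument, applied to a regular vector. Since t is complex, the generic
  point must be such that a root whose real part vanishes there vanishes altogether; this is
  possible because the fixed space is closed under multiplication by i. The flag stabiliser acts on
  B with kernel W_h1. The kernel is carried along instead of being divided out: freeness means that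
  an element with one fixed point acts trivially, and the quotient group appears only as the target
  of the connecting map. The orbit space is a quotient topology on sets of tuples, so lifting and
  loop classes are treated for abstract topologies.\<close>

lemma clin_funD:
  assumes "clin_fun f"
  shows "f (x + y) = f x + f y" "f (c *s x) = c * f x" "f (x - y) = f x - f y" "f 0 = 0"
proof -
  show a: "f (x + y) = f x + f y" for x y using assms by (simp add: clin_fun_def)
  show b: "f (c *s x) = c * f x" for c x using assms by (simp add: clin_fun_def)
  have "f (x - y) + f y = f x" using a[of "x - y" y] by simp
  then show "f (x - y) = f x - f y" by (simp add: algebra_simps)
  show "f 0 = 0" using a[of 0 0] by simp
qed

lemma of_real_vector_scalar_mult: "complex_of_real r *s x = r *\<^sub>R x"
  by (simp add: vec_eq_iff scaleR_conv_of_real[where 'a=complex])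

lemma clin_fun_linear: "clin_fun f \<Longrightarrow> linear f"
  by (rule linearI)
     (simp_all add: clin_funD flip: of_real_vector_scalar_mult, simp add: scaleR_conv_of_real)

lemma clin_fun_continuous_on: "clin_fun f \<Longrightarrow> continuous_on S f"
  by (simp add: clin_fun_linear linear_continuous_on linear_linear)

lemma continuous_on_vector_scalar_mult:
  fixes h :: "complex^'n"
  assumes "continuous_on S f"
  shows "continuous_on S (\<lambda>x. f x *s h)"
proof -
  have "(\<lambda>x. f x *s h) = (\<lambda>x. \<chi> i. f x * h $ i)"
    by (auto simp: vec_eq_iff)
  then show ?thesis
    using continuous_on_vec_lambda[OF continuous_on_mult_right[OF assms], of "\<lambda>i. h $ i"] by metis
qed

text \<open>A real vector space is not a finite union of proper subspaces. Inductively, start from a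
  vector \<open>v\<close> with f v \<noteq> 0 and move it along a vector \<open>y\<close> that is
  good for \<open>F\<close>: every functional not killing \<open>y\<close> excludes a single value
  of the parameter.\<close>

lemma ex_nonvanishing_vector:
  fixes S :: "'a::real_vector set"
  assumes "finite F" and "0 \<in> S"
    and add: "\<And>x y. x \<in> S \<Longrightarrow> y \<in> S \<Longrightarrow> x + y \<in> S"
    and scale: "\<And>r x. x \<in> S \<Longrightarrow> r *\<^sub>R x \<in> S"
    and "\<And>f. f \<in> F \<Longrightarrow> linear f" and "\<And>f. f \<in> F \<Longrightarrow> \<exists>v\<in>S. f v \<noteq> (0::real)"
  shows "\<exists>y\<in>S. \<forall>f\<in>F. f y \<noteq> 0"
  using assms(1,5,6)
proof (induction F rule: finite_induct)
  case empty
  then show ?case using \<open>0 \<in> S\<close> by auto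
next
  case (insert f F)
  then obtain y v where y: "y \<in> S" "\<forall>g\<in>F. g y \<noteq> 0" and v: "v \<in> S" "f v \<noteq> 0"
    by blast
  have lin: "linear g" if "g \<in> insert f F" for g using insert that by blast
  define bad where "bad = {t. \<exists>g\<in>insert f F. g (v + t *\<^sub>R y) = 0 \<and> g y \<noteq> 0}"
  have "bad \<subseteq> (\<lambda>g. - g v / g y) ` insert f F"
  proof
    fix t assume "t \<in> bad"
    then obtain g where g: "g \<in> insert f F" "g (v + t *\<^sub>R y) = 0" "g y \<noteq> 0"
      by (auto simp: bad_def)
    then have "g v + t * g y = 0"
      by (simp add: linear_add[OF lin[OF g(1)]] linear_scale[OF lin[OF g(1)]])
    then have "t = - g v / g y" using g(3) by (simp add: field_simps)
    then show "t \<in> (\<lambda>g. - g v / g y) ` insert f F" using g(1) by blast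
  qed
  then have "finite bad" using insert(1) finite_subset by blast
  then obtain t where t: "t \<notin> bad"
    using ex_new_if_finite infinite_UNIV_char_0 by blast
  \<comment> \<open>Only the new functional \<open>f\<close> can vanish at \<open>y\<close>, and
    then its value is f v for every parameter; all others are covered by the choice of
    \<open>t\<close>.\<close>
  have "g (v + t *\<^sub>R y) \<noteq> 0" if g: "g \<in> insert f F" for g
  proof (cases "g y = 0")
    case True
    then have "g = f" using g y by auto
    then show ?thesis
      using v True linear_add[OF lin[OF g]] linear_scale[OF lin[OF g]] by simp
  qed (use t g in \<open>auto simp: bad_def\<close>)
  then show ?case using add scale v y by blast
qed

lemma weyl_group_comp:
  assumes "u \<in> weyl_group \<Psi> cor" "w \<in> weyl_group \<Psi> cor"
  shows "u \<circ> w \<in> weyl_group \<Psi> cor"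
  using assms by (induction rule: weyl_group.induct) (auto simp: comp_assoc intro: weyl_group.intros)

lemma weyl_group_refl: "\<alpha> \<in> \<Psi> \<Longrightarrow> rrefl \<alpha> (cor \<alpha>) \<in> weyl_group \<Psi> cor"
  using weyl_step[OF weyl_id] by fastforce

lemma weyl_group_mono:
  assumes "\<Psi> \<subseteq> \<Phi>" shows "weyl_group \<Psi> cor \<subseteq> weyl_group \<Phi> cor"
proof
  fix w assume "w \<in> weyl_group \<Psi> cor"
  then show "w \<in> weyl_group \<Phi> cor"
    by induction (use assms weyl_group.intros in blast)+
qed

lemma weyl_group_empty: "weyl_group {} cor = {id}"
  by (auto elim: weyl_group.cases intro: weyl_group.intros)

lemma weyl_group_fixes:
  assumes "w \<in> weyl_group \<Psi> cor" "\<And>\<alpha>. \<alpha> \<in> \<Psi> \<Longrightarrow> \<alpha> x = 0"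
  shows "w x = x"
  using assms by induction (auto simp: rrefl_def)

section \<open>Reflections, the Weyl group and its invariant form\<close>

locale root_datum =
  fixes \<Phi> :: "(complex^'n \<Rightarrow> complex) set"
    and cor :: "(complex^'n \<Rightarrow> complex) \<Rightarrow> complex^'n"
  assumes datum: "reduced_root_datum \<Phi> cor"
begin

abbreviation refl where "refl \<alpha> \<equiv> rrefl \<alpha> (cor \<alpha>)"
abbreviation W where "W \<equiv> weyl_group \<Phi> cor"

lemma
  shows finite_roots: "finite \<Phi>"
    and root_clin: "\<alpha> \<in> \<Phi> \<Longrightarrow> clin_fun \<alpha>"
    and root_coroot: "\<alpha> \<in> \<Phi> \<Longrightarrow> \<alpha> (cor \<alpha>) = 2"
    and root_int: "\<alpha> \<in> \<Phi> \<Longrightarrow> \<beta> \<in> \<Phi> \<Longrightarrow> \<beta> (cor \<alpha>) \<in> \<int>"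
    and root_refl: "\<alpha> \<in> \<Phi> \<Longrightarrow> \<beta> \<in> \<Phi> \<Longrightarrow> \<beta> \<circ> refl \<alpha> \<in> \<Phi>"
    and coroot_refl: "\<alpha> \<in> \<Phi> \<Longrightarrow> \<beta> \<in> \<Phi> \<Longrightarrow> cor (\<beta> \<circ> refl \<alpha>) = refl \<alpha> (cor \<beta>)"
    and root_reduced: "\<alpha> \<in> \<Phi> \<Longrightarrow> (\<lambda>X. c * \<alpha> X) \<in> \<Phi> \<Longrightarrow> c = 1 \<or> c = -1"
  using datum unfolding reduced_root_datum_def by blast+

lemma root_Re_linear: "\<alpha> \<in> \<Phi> \<Longrightarrow> linear (\<lambda>x. Re (\<alpha> x))"
  using linear_compose[OF clin_fun_linear[OF root_clin], of \<alpha> Re]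
  by (simp add: bounded_linear.linear bounded_linear_Re comp_def)

lemma root_refl_apply:
  assumes "\<alpha> \<in> \<Phi>" "\<beta> \<in> \<Phi>"
  shows "\<beta> (refl \<alpha> X) = \<beta> X - \<alpha> X * \<beta> (cor \<alpha>)"
  using clin_funD[OF root_clin[OF assms(2)]] by (simp add: rrefl_def)

lemma refl_self: "\<alpha> \<in> \<Phi> \<Longrightarrow> \<alpha> (refl \<alpha> X) = - \<alpha> X"
  by (simp add: root_refl_apply root_coroot)

lemma refl_refl: "\<alpha> \<in> \<Phi> \<Longrightarrow> refl \<alpha> (refl \<alpha> X) = X"
  unfolding rrefl_def[of _ _ "rrefl _ _ _"] refl_self by (simp add: rrefl_def)

lemma refl_comp_refl: "\<alpha> \<in> \<Phi> \<Longrightarrow> refl \<alpha> \<circ> refl \<alpha> = id"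
  by (auto simp: refl_refl)

lemma root_uminus: "\<alpha> \<in> \<Phi> \<Longrightarrow> (\<lambda>X. - \<alpha> X) \<in> \<Phi>"
  using root_refl[of \<alpha> \<alpha>] by (simp add: refl_self comp_def)

lemma refl_linear:
  assumes "\<alpha> \<in> \<Phi>"
  shows "refl \<alpha> (X + Y) = refl \<alpha> X + refl \<alpha> Y" "refl \<alpha> (c *s X) = c *s refl \<alpha> X"
  by (simp_all add: rrefl_def clin_funD[OF root_clin[OF assms]] algebra_simps vec_eq_iff)

lemma refl_continuous: "\<alpha> \<in> \<Phi> \<Longrightarrow> continuous_on UNIV (refl \<alpha>)"
  unfolding rrefl_def
  by (intro continuous_intros continuous_on_vector_scalar_mult clin_fun_continuous_on root_clin)

lemma W_linear:
  assumes "w \<in> W"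
  shows "w (X + Y) = w X + w Y" "w (c *s X) = c *s w X"
  using assms by (induction arbitrary: X Y c) (auto simp: refl_linear)

lemma W_continuous: "w \<in> W \<Longrightarrow> continuous_on UNIV w"
proof (induction rule: weyl_group.induct)
  case (weyl_step w \<alpha>)
  then show ?case using continuous_on_compose continuous_on_subset refl_continuous by blast
qed (simp add: continuous_on_id')

lemma W_root: "w \<in> W \<Longrightarrow> \<alpha> \<in> \<Phi> \<Longrightarrow> \<alpha> \<circ> w \<in> \<Phi>"
  by (induction arbitrary: \<alpha> rule: weyl_group.induct) (auto simp: root_refl simp flip: comp_assoc)

text \<open>The inductive definition only yields a monoid; inverses exist because each generator is
  an involution and words can be reversed. The subset \<Psi> is general because the group generated
  by a base needs inverses of its own before it is known to be all of W.\<close>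

lemma W_inverse:
  assumes "w \<in> weyl_group \<Psi> cor" "\<Psi> \<subseteq> \<Phi>"
  shows "\<exists>v\<in>weyl_group \<Psi> cor. v \<circ> w = id \<and> w \<circ> v = id"
  using assms
proof (induction)
  case weyl_id
  show ?case by (rule bexI[OF _ weyl_group.weyl_id]) simp
next
  case (weyl_step w \<alpha>)
  then obtain v where v: "v \<in> weyl_group \<Psi> cor" "v \<circ> w = id" "w \<circ> v = id" by blast
  have \<alpha>: "\<alpha> \<in> \<Phi>" using weyl_step by blast
  have "v (refl \<alpha> (refl \<alpha> (w x))) = x" "refl \<alpha> (w (v (refl \<alpha> x))) = x" for x
    using v(2,3) refl_refl[OF \<alpha>] by (simp_all add: fun_eq_iff)
  then have "(v \<circ> refl \<alpha>) \<circ> (refl \<alpha> \<circ> w) = id" "(refl \<alpha> \<circ> w) \<circ> (v \<circ> refl \<alpha>) = id"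
    by auto
  then show ?case
    using weyl_group_comp[OF v(1) weyl_group_refl[where \<Psi>=\<Psi>, OF weyl_step(2)]] by blast
qed

lemma W_coroot: "w \<in> W \<Longrightarrow> \<alpha> \<in> \<Phi> \<Longrightarrow> w (cor (\<alpha> \<circ> w)) = cor \<alpha>"
proof (induction arbitrary: \<alpha> rule: weyl_group.induct)
  case (weyl_step w \<beta>)
  have "w (cor (\<alpha> \<circ> (refl \<beta> \<circ> w))) = refl \<beta> (cor \<alpha>)"
    using weyl_step(3)[OF root_refl[OF weyl_step(2,4)]] coroot_refl[OF weyl_step(2,4)]
    by (simp only: comp_assoc)
  then show ?case using refl_refl[OF weyl_step(2)] by (simp add: comp_def)
qed (simp add: comp_def)

text \<open>This is the conjugation formula for reflections, w^-1 s_\<alpha> w = s_\<beta> with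
  \<beta> = \<alpha> \<circ> w; it rests on the equivariance of coroots. Roots are moved from the
  right, by composition.\<close>

lemma refl_W_commute:
  assumes "w \<in> W" "\<alpha> \<in> \<Phi>"
  shows "refl \<alpha> \<circ> w = w \<circ> refl (\<alpha> \<circ> w)"
proof
  fix X
  have "w (refl (\<alpha> \<circ> w) X) + \<alpha> (w X) *s cor \<alpha> = w X"
    using W_linear(1)[OF assms(1), of "refl (\<alpha> \<circ> w) X" "\<alpha> (w X) *s cor (\<alpha> \<circ> w)"]
    by (simp add: W_coroot[OF assms] W_linear(2)[OF assms(1)] rrefl_def)
  then show "(refl \<alpha> \<circ> w) X = (w \<circ> refl (\<alpha> \<circ> w)) X"
    by (simp add: rrefl_def[of \<alpha>] algebra_simps)
qed

text \<open>The sum over \<gamma> of \<alpha>(\<gamma>^v) \<beta>(\<gamma>^v) acts as the invariant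
  form (\<alpha>, \<beta>). Since s_\<alpha> permutes the roots, the sum may be reindexed; comparing
  both versions gives the classical relation 2 (\<alpha>, \<beta>) = \<beta>(\<alpha>^v) (\<alpha>,
  \<alpha>).\<close>

lemma dual_form_root:
  assumes "\<alpha> \<in> \<Phi>" "\<beta> \<in> \<Phi>"
  shows "2 * (\<Sum>\<gamma>\<in>\<Phi>. \<alpha> (cor \<gamma>) * \<beta> (cor \<gamma>)) = \<beta> (cor \<alpha>) * (\<Sum>\<gamma>\<in>\<Phi>. \<alpha> (cor \<gamma>) * \<alpha> (cor \<gamma>))"
proof -
  have bij: "bij_betw (\<lambda>\<gamma>. \<gamma> \<circ> refl \<alpha>) \<Phi> \<Phi>"
    by (rule bij_betwI[where g="\<lambda>\<gamma>. \<gamma> \<circ> refl \<alpha>"])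
       (auto simp: root_refl assms comp_assoc refl_comp_refl)
  have "(\<Sum>\<gamma>\<in>\<Phi>. \<alpha> (cor \<gamma>) * \<beta> (cor \<gamma>))
      = (\<Sum>\<gamma>\<in>\<Phi>. \<alpha> (cor (\<gamma> \<circ> refl \<alpha>)) * \<beta> (cor (\<gamma> \<circ> refl \<alpha>)))"
    by (rule sum.reindex_bij_betw[OF bij, symmetric])
  also have "\<dots> = (\<Sum>\<gamma>\<in>\<Phi>. - \<alpha> (cor \<gamma>) * (\<beta> (cor \<gamma>) - \<alpha> (cor \<gamma>) * \<beta> (cor \<alpha>)))"
    by (intro sum.cong) (simp_all add: coroot_refl refl_self root_refl_apply assms)
  also have "\<dots> = - (\<Sum>\<gamma>\<in>\<Phi>. \<alpha> (cor \<gamma>) * \<beta> (cor \<gamma>))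
      + \<beta> (cor \<alpha>) * (\<Sum>\<gamma>\<in>\<Phi>. \<alpha> (cor \<gamma>) * \<alpha> (cor \<gamma>))"
    by (simp add: algebra_simps sum.distrib sum_negf sum_subtractf sum_distrib_left)
  finally show ?thesis by (simp add: algebra_simps)
qed

lemma ex_regular_vector: "\<exists>Y. \<forall>\<alpha>\<in>\<Phi>. Re (\<alpha> Y) \<noteq> 0"
proof -
  have "\<exists>y\<in>UNIV. \<forall>f\<in>(\<lambda>\<alpha> x. Re (\<alpha> x)) ` \<Phi>. f y \<noteq> 0"
  proof (rule ex_nonvanishing_vector)
    fix f assume "f \<in> (\<lambda>\<alpha> x. Re (\<alpha> x)) ` \<Phi>"
    then obtain \<alpha> where "\<alpha> \<in> \<Phi>" "f = (\<lambda>x. Re (\<alpha> x))" by blast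
    then show "\<exists>v\<in>UNIV. f v \<noteq> 0" by (intro bexI[of _ "cor \<alpha>"]) (auto simp: root_coroot)
  qed (use finite_roots root_Re_linear in auto)
  then show ?thesis by auto
qed

end

section \<open>Positive systems and their bases\<close>

locale positive_system = root_datum \<Phi> cor
  for \<Phi> :: "(complex^'n \<Rightarrow> complex) set" and cor +
  fixes Y :: "complex^'n"
  assumes regular: "\<And>\<alpha>. \<alpha> \<in> \<Phi> \<Longrightarrow> Re (\<alpha> Y) \<noteq> 0"
begin

definition pos where "pos = {\<alpha>\<in>\<Phi>. Re (\<alpha> Y) > 0}"

definition spans_pos where
  "spans_pos D \<longleftrightarrow> (\<forall>\<beta>\<in>pos. \<exists>c. (\<forall>\<delta>\<in>D. c \<delta> \<ge> 0) \<and> (\<forall>X. \<beta> X = (\<Sum>\<delta>\<in>D. complex_of_real (c \<delta>) * \<delta> X)))"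

text \<open>Simple roots, encoded as an irredundant set of generators of the cone of positive roots,
  so that existence follows from finiteness alone.\<close>

definition base where
  "base D \<longleftrightarrow> D \<subseteq> pos \<and> spans_pos D \<and> (\<forall>\<alpha>\<in>D. \<not> spans_pos (D - {\<alpha>}))"

lemma pos_root: "\<alpha> \<in> pos \<Longrightarrow> \<alpha> \<in> \<Phi>" and pos_height: "\<alpha> \<in> pos \<Longrightarrow> Re (\<alpha> Y) > 0"
  by (simp_all add: pos_def)

lemma finite_pos: "finite pos"
  by (simp add: pos_def finite_roots)

lemma not_pos_iff: "\<alpha> \<in> \<Phi> \<Longrightarrow> \<alpha> \<notin> pos \<longleftrightarrow> (\<lambda>X. - \<alpha> X) \<in> pos"
  using regular[of \<alpha>] root_uminus[of \<alpha>] by (auto simp: pos_def)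

lemma ex_base: "\<exists>D. base D"
proof -
  have "spans_pos pos"
    unfolding spans_pos_def
  proof
    fix \<beta> assume "\<beta> \<in> pos"
    then have "\<beta> X = (\<Sum>\<delta>\<in>pos. complex_of_real (if \<delta> = \<beta> then 1 else 0) * \<delta> X)" for X
      using finite_pos by (simp add: if_distrib if_distribR sum.delta cong: if_cong)
    then show "\<exists>c. (\<forall>\<delta>\<in>pos. c \<delta> \<ge> 0) \<and> (\<forall>X. \<beta> X = (\<Sum>\<delta>\<in>pos. complex_of_real (c \<delta>) * \<delta> X))"
      by (intro exI[of _ "\<lambda>\<delta>. if \<delta> = \<beta> then 1 else 0"]) auto
  qed
  then obtain D where D: "D \<subseteq> pos \<and> spans_pos D"
      and min: "\<And>D'. D' \<subseteq> pos \<and> spans_pos D' \<Longrightarrow> card D \<le> card D'"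
    using ex_has_least_nat[of "\<lambda>D. D \<subseteq> pos \<and> spans_pos D" pos card] by blast
  have "\<not> spans_pos (D - {\<alpha>})" if "\<alpha> \<in> D" for \<alpha>
    using min[of "D - {\<alpha>}"] D that finite_subset[OF _ finite_pos, of D] card_Diff1_less[of D \<alpha>] by fastforce
  then show ?thesis using D by (auto simp: base_def)
qed

context
  fixes D assumes D: "base D"
begin

lemma base_pos: "\<alpha> \<in> D \<Longrightarrow> \<alpha> \<in> pos" and base_root: "\<alpha> \<in> D \<Longrightarrow> \<alpha> \<in> \<Phi>"
  using D by (auto simp: base_def pos_def)

lemma finite_base: "finite D"
  using D finite_pos finite_subset by (auto simp: base_def)

lemma base_expand:
  assumes "\<beta> \<in> pos"
  obtains c where "\<And>\<delta>. \<delta> \<in> D \<Longrightarrow> c \<delta> \<ge> (0::real)"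
    "\<And>X. \<beta> X = (\<Sum>\<delta>\<in>D. complex_of_real (c \<delta>) * \<delta> X)"
  using assms D unfolding base_def spans_pos_def by blast

text \<open>Substituting the given expression for \<alpha> into the expansions of all positive roots
  shows that the remaining elements still generate the cone.\<close>

lemma base_irredundant:
  assumes \<alpha>: "\<alpha> \<in> D" and k: "\<And>\<delta>. \<delta> \<in> D - {\<alpha>} \<Longrightarrow> k \<delta> \<ge> 0"
    and eq: "\<And>X. \<alpha> X = (\<Sum>\<delta>\<in>D - {\<alpha>}. complex_of_real (k \<delta>) * \<delta> X)"
  shows False
proof -
  have "spans_pos (D - {\<alpha>})"
    unfolding spans_pos_def
  proof
    fix \<beta> assume "\<beta> \<in> pos"
    then obtain c where c: "\<And>\<delta>. \<delta> \<in> D \<Longrightarrow> c \<delta> \<ge> (0::real)"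
        "\<And>X. \<beta> X = (\<Sum>\<delta>\<in>D. complex_of_real (c \<delta>) * \<delta> X)"
      using base_expand by blast
    have "\<beta> X = (\<Sum>\<delta>\<in>D - {\<alpha>}. complex_of_real (c \<delta> + c \<alpha> * k \<delta>) * \<delta> X)" for X
    proof -
      have "\<beta> X = complex_of_real (c \<alpha>) * \<alpha> X + (\<Sum>\<delta>\<in>D - {\<alpha>}. complex_of_real (c \<delta>) * \<delta> X)"
        unfolding c(2) by (rule sum.remove[OF finite_base \<alpha>])
      also have "\<dots> = (\<Sum>\<delta>\<in>D - {\<alpha>}. complex_of_real (c \<delta> + c \<alpha> * k \<delta>) * \<delta> X)"
        by (subst eq) (simp only: of_real_add of_real_mult distrib_right sum.distrib sum_distrib_left
            mult.assoc add.commute)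
      finally show ?thesis .
    qed
    then show "\<exists>c. (\<forall>\<delta>\<in>D - {\<alpha>}. c \<delta> \<ge> 0) \<and> (\<forall>X. \<beta> X = (\<Sum>\<delta>\<in>D - {\<alpha>}. complex_of_real (c \<delta>) * \<delta> X))"
      using c(1) k \<alpha> by (intro exI[of _ "\<lambda>\<delta>. c \<delta> + c \<alpha> * k \<delta>"]) auto
  qed
  then show False using D \<alpha> by (auto simp: base_def)
qed

text \<open>If the reflected root were negative, \<beta> and \<gamma> = - \<beta> \<circ> s_\<alpha>
  would be positive roots with sum a multiple of \<alpha>. Comparing expansions over the base,
  either \<alpha> is a combination of the other generators, or \<beta> is proportional to \<alpha>
  and hence equal to it because the system is reduced.\<close>

lemma base_refl_pos:
  assumes \<alpha>: "\<alpha> \<in> D" and \<beta>: "\<beta> \<in> pos" and ne: "\<beta> \<noteq> \<alpha>"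
  shows "\<beta> \<circ> refl \<alpha> \<in> pos"
proof (rule ccontr)
  assume neg: "\<beta> \<circ> refl \<alpha> \<notin> pos"
  note \<alpha>\<Phi> = base_root[OF \<alpha>] and \<beta>\<Phi> = pos_root[OF \<beta>]
  define n where "n = Re (\<beta> (cor \<alpha>))"
  have n: "\<beta> (cor \<alpha>) = of_real n"
    using root_int[OF \<alpha>\<Phi> \<beta>\<Phi>] by (auto simp: n_def elim!: Ints_cases)
  define \<gamma> where "\<gamma> = (\<lambda>X. - \<beta> (refl \<alpha> X))"
  have \<gamma>: "\<gamma> \<in> pos"
    using neg not_pos_iff[OF root_refl[OF \<alpha>\<Phi> \<beta>\<Phi>]] by (simp add: \<gamma>_def)
  have sum: "of_real n * \<alpha> X = \<beta> X + \<gamma> X" for X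
    by (simp add: \<gamma>_def root_refl_apply \<alpha>\<Phi> \<beta>\<Phi> n)
  obtain b where b: "\<And>\<delta>. \<delta> \<in> D \<Longrightarrow> b \<delta> \<ge> (0::real)"
      "\<And>X. \<beta> X = (\<Sum>\<delta>\<in>D. complex_of_real (b \<delta>) * \<delta> X)"
    using base_expand[OF \<beta>] by blast
  obtain c where c: "\<And>\<delta>. \<delta> \<in> D \<Longrightarrow> c \<delta> \<ge> (0::real)"
      "\<And>X. \<gamma> X = (\<Sum>\<delta>\<in>D. complex_of_real (c \<delta>) * \<delta> X)"
    using base_expand[OF \<gamma>] by blast
  \<comment> \<open>The coefficient of \<alpha> that remains after the \<alpha>-parts of \<beta> and
    \<gamma> are subtracted from n \<alpha>; its sign decides which contradiction arises.\<close>
  define m where "m = n - b \<alpha> - c \<alpha>"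
  have \<beta>_split: "\<beta> X = of_real (b \<alpha>) * \<alpha> X + (\<Sum>\<delta>\<in>D - {\<alpha>}. complex_of_real (b \<delta>) * \<delta> X)" for X
    unfolding b(2) by (rule sum.remove[OF finite_base \<alpha>])
  have \<gamma>_split: "\<gamma> X = of_real (c \<alpha>) * \<alpha> X + (\<Sum>\<delta>\<in>D - {\<alpha>}. complex_of_real (c \<delta>) * \<delta> X)" for X
    unfolding c(2) by (rule sum.remove[OF finite_base \<alpha>])
  have m: "of_real m * \<alpha> X = (\<Sum>\<delta>\<in>D - {\<alpha>}. complex_of_real (b \<delta> + c \<delta>) * \<delta> X)" for X
    using sum[of X] unfolding \<beta>_split \<gamma>_split m_def
    by (simp add: algebra_simps sum.distrib)
  show False
  proof (cases "m > 0")
    case True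
    have "\<alpha> X = (\<Sum>\<delta>\<in>D - {\<alpha>}. complex_of_real ((b \<delta> + c \<delta>) / m) * \<delta> X)" for X
    proof -
      have "\<alpha> X = of_real (1/m) * (of_real m * \<alpha> X)" using True by simp
      then show ?thesis unfolding m by (simp add: sum_distrib_left)
    qed
    then show False
      using base_irredundant[OF \<alpha>, of "\<lambda>\<delta>. (b \<delta> + c \<delta>) / m"] b(1) c(1) True by simp
  next
    case False
    \<comment> \<open>At \<open>Y\<close> the left side of \<open>m\<close> is now at most 0, while
      the right side is a sum of nonnegative terms with positive heights; so all coefficients other
      than that of \<alpha> vanish.\<close>
    have nonneg: "0 \<le> (b \<delta> + c \<delta>) * Re (\<delta> Y)" if "\<delta> \<in> D - {\<alpha>}" for \<delta>
      using b(1)[of \<delta>] c(1)[of \<delta>] pos_height[OF base_pos, of \<delta>] that by simp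
    have "m * Re (\<alpha> Y) = (\<Sum>\<delta>\<in>D - {\<alpha>}. (b \<delta> + c \<delta>) * Re (\<delta> Y))"
      using arg_cong[OF m[of Y], of Re] by simp
    moreover have "m * Re (\<alpha> Y) \<le> 0"
      using False pos_height[OF base_pos[OF \<alpha>]] by (simp add: mult_le_0_iff)
    ultimately have "(\<Sum>\<delta>\<in>D - {\<alpha>}. (b \<delta> + c \<delta>) * Re (\<delta> Y)) = 0"
      using sum_nonneg[OF nonneg, of "D - {\<alpha>}" "\<lambda>x. x"] by simp
    then have z: "(b \<delta> + c \<delta>) * Re (\<delta> Y) = 0" if "\<delta> \<in> D - {\<alpha>}" for \<delta>
      using sum_nonneg_eq_0_iff[OF _ nonneg, of "D - {\<alpha>}" "\<lambda>x. x"] finite_base that by simp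
    have "b \<delta> = 0" if "\<delta> \<in> D - {\<alpha>}" for \<delta>
      using z[OF that] b(1)[of \<delta>] c(1)[of \<delta>] pos_height[OF base_pos, of \<delta>] that by force
    then have eq: "\<beta> = (\<lambda>X. of_real (b \<alpha>) * \<alpha> X)"
      unfolding fun_eq_iff \<beta>_split by simp
    have "complex_of_real (b \<alpha>) = 1 \<or> complex_of_real (b \<alpha>) = -1"
      using root_reduced[OF \<alpha>\<Phi>, of "of_real (b \<alpha>)"] \<beta>\<Phi> eq by simp
    then have "b \<alpha> = 1 \<or> b \<alpha> = -1"
      by (metis of_real_1 of_real_eq_iff of_real_minus)
    then have "b \<alpha> = 1" using b(1)[OF \<alpha>] by simp
    then show False using eq ne by (simp add: fun_eq_iff)
  qed
qed

text \<open>A positive root of minimal height in its orbit is in the base: otherwise it would have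
  non-positive pairing with every element of the base, hence with itself.\<close>

lemma refl_in_base_group:
  assumes \<beta>: "\<beta> \<in> pos"
  shows "refl \<beta> \<in> weyl_group D cor"
proof -
  let ?V = "weyl_group D cor"
  have VW: "w \<in> W" if "w \<in> ?V" for w
    using weyl_group_mono[of D \<Phi> cor] base_root that by blast
  let ?O = "{\<gamma>\<in>pos. \<exists>w\<in>?V. \<gamma> = \<beta> \<circ> w}"
  have "\<beta> \<in> ?O" using \<beta> by (auto intro!: bexI[OF _ weyl_id])
  moreover have "finite ?O" using finite_pos by simp
  ultimately obtain \<gamma> where \<gamma>: "\<gamma> \<in> ?O" and min: "\<And>\<delta>. \<delta> \<in> ?O \<Longrightarrow> Re (\<gamma> Y) \<le> Re (\<delta> Y)"
    using ex_is_arg_min_if_finite[of ?O "\<lambda>\<delta>. Re (\<delta> Y)"] unfolding is_arg_min_linorder by blast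
  then obtain w where w: "w \<in> ?V" "\<gamma> = \<beta> \<circ> w" by blast
  have \<gamma>pos: "\<gamma> \<in> pos" and \<gamma>\<Phi>: "\<gamma> \<in> \<Phi>" using \<gamma> pos_root by auto
  have "\<gamma> \<in> D"
  proof (rule ccontr)
    assume nD: "\<gamma> \<notin> D"
    \<comment> \<open>Since \<gamma> is positive and differs from \<alpha>, its reflection stays
      positive and in the orbit. Minimality then compares the height \<gamma>(Y) with \<gamma>(Y) -
      \<alpha>(Y) \<gamma>(\<alpha>^v).\<close>
    have le: "Re (\<gamma> (cor \<alpha>)) \<le> 0" if \<alpha>: "\<alpha> \<in> D" for \<alpha>
    proof -
      have "\<gamma> \<circ> refl \<alpha> \<in> pos" using base_refl_pos[OF \<alpha> \<gamma>pos] nD \<alpha> by blast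
      moreover have "w \<circ> refl \<alpha> \<in> ?V"
        using weyl_group_comp[OF w(1) weyl_group_refl[where \<Psi>=D, OF \<alpha>]] .
      ultimately have "\<gamma> \<circ> refl \<alpha> \<in> ?O" using w(2) comp_assoc by blast
      then have "Re (\<gamma> Y) \<le> Re (\<gamma> (refl \<alpha> Y))" using min[of "\<gamma> \<circ> refl \<alpha>"] by (simp only: comp_apply)
      moreover have "Im (\<gamma> (cor \<alpha>)) = 0"
        using root_int[OF base_root[OF \<alpha>] \<gamma>\<Phi>] by (auto elim!: Ints_cases)
      ultimately have "Re (\<alpha> Y) * Re (\<gamma> (cor \<alpha>)) \<le> 0"
        by (simp add: root_refl_apply base_root \<alpha> \<gamma>\<Phi>)
      then show ?thesis using pos_height[OF base_pos[OF \<alpha>]] by (simp add: mult_le_0_iff)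
    qed
    \<comment> \<open>The real part of the form in \<open>dual_form_root\<close>. All pairings are
      integers, so real parts are multiplicative on them and \<open>B \<alpha> \<alpha>\<close> is a
      sum of squares, with a positive term coming from \<alpha> itself.\<close>
    define B where "B = (\<lambda>\<alpha> \<beta>. Re (\<Sum>\<delta>\<in>\<Phi>. \<alpha> (cor \<delta>) * \<beta> (cor \<delta>)))"
    have ReB: "Re (\<alpha> (cor \<delta>) * \<beta> (cor \<delta>)) = Re (\<alpha> (cor \<delta>)) * Re (\<beta> (cor \<delta>))"
      if "\<alpha> \<in> \<Phi>" "\<beta> \<in> \<Phi>" "\<delta> \<in> \<Phi>" for \<alpha> \<beta> \<delta>
      using root_int[OF that(3,1)] root_int[OF that(3,2)] by (auto elim!: Ints_cases)
    have Bpos: "B \<alpha> \<alpha> > 0" if \<alpha>: "\<alpha> \<in> \<Phi>" for \<alpha>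
    proof -
      have "B \<alpha> \<alpha> = (\<Sum>\<delta>\<in>\<Phi>. Re (\<alpha> (cor \<delta>)) * Re (\<alpha> (cor \<delta>)))"
        unfolding B_def Re_sum using ReB \<alpha> by (intro sum.cong) auto
      also have "\<dots> > 0"
        using \<alpha> finite_roots root_coroot[OF \<alpha>] by (intro sum_pos2[of _ \<alpha>]) auto
      finally show ?thesis .
    qed
    have Bcor: "2 * B \<alpha> \<gamma> = Re (\<gamma> (cor \<alpha>)) * B \<alpha> \<alpha>" if \<alpha>: "\<alpha> \<in> \<Phi>" for \<alpha>
    proof -
      obtain k where k: "\<gamma> (cor \<alpha>) = of_int k"
        using root_int[OF \<alpha> \<gamma>\<Phi>] by (auto elim: Ints_cases)
      show ?thesis
        using arg_cong[OF dual_form_root[OF \<alpha> \<gamma>\<Phi>], of Re] unfolding k B_def by simp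
    qed
    obtain c where c: "\<And>\<delta>. \<delta> \<in> D \<Longrightarrow> c \<delta> \<ge> (0::real)"
      "\<And>X. \<gamma> X = (\<Sum>\<delta>\<in>D. complex_of_real (c \<delta>) * \<delta> X)"
      using base_expand[OF \<gamma>pos] by blast
    have "(\<Sum>\<delta>\<in>\<Phi>. \<gamma> (cor \<delta>) * \<gamma> (cor \<delta>))
        = (\<Sum>\<delta>\<in>\<Phi>. \<Sum>\<alpha>\<in>D. of_real (c \<alpha>) * (\<alpha> (cor \<delta>) * \<gamma> (cor \<delta>)))"
      by (subst (1) c(2)) (simp add: sum_distrib_right mult.assoc)
    also have "\<dots> = (\<Sum>\<alpha>\<in>D. of_real (c \<alpha>) * (\<Sum>\<delta>\<in>\<Phi>. \<alpha> (cor \<delta>) * \<gamma> (cor \<delta>)))"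
      by (subst sum.swap) (simp add: sum_distrib_left)
    finally have "B \<gamma> \<gamma> = (\<Sum>\<alpha>\<in>D. c \<alpha> * B \<alpha> \<gamma>)"
      unfolding B_def by simp
    also have "\<dots> \<le> 0"
    proof (rule sum_nonpos)
      fix \<alpha> assume \<alpha>: "\<alpha> \<in> D"
      have "2 * B \<alpha> \<gamma> \<le> 0"
        unfolding Bcor[OF base_root[OF \<alpha>]]
        using le[OF \<alpha>] Bpos[OF base_root[OF \<alpha>]] by (simp add: mult_le_0_iff)
      then show "c \<alpha> * B \<alpha> \<gamma> \<le> 0" using c(1)[OF \<alpha>] by (simp add: mult_le_0_iff)
    qed
    finally show False using Bpos[OF \<gamma>\<Phi>] by simp
  qed
  obtain v where v: "v \<in> ?V" "v \<circ> w = id" "w \<circ> v = id"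
    using W_inverse[OF w(1)] base_root by blast
  \<comment> \<open>Conjugating back: s_\<beta> = w s_\<gamma> w^-1, where \<gamma> is now known to
    be simple.\<close>
  have "refl \<beta> = refl \<beta> \<circ> w \<circ> v" by (simp add: comp_assoc v)
  also have "\<dots> = w \<circ> refl \<gamma> \<circ> v"
    using refl_W_commute[OF VW[OF w(1)] pos_root[OF \<beta>]] w(2) by simp
  finally show ?thesis
    using w(1) v(1) weyl_group_refl[where \<Psi>=D, OF \<open>\<gamma> \<in> D\<close>] weyl_group_comp by metis
qed

lemma base_generates: "weyl_group D cor = W"
proof
  show "weyl_group D cor \<subseteq> W" by (rule weyl_group_mono) (use base_root in blast)
  have refl: "refl \<alpha> \<in> weyl_group D cor" if \<alpha>: "\<alpha> \<in> \<Phi>" for \<alpha>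
  proof (cases "\<alpha> \<in> pos")
    case False
    \<comment> \<open>The coroot of -\<alpha> is not prescribed directly; writing -\<alpha> as
      \<alpha> \<circ> s_\<alpha> lets equivariance determine it, so opposite roots have the same
      reflection.\<close>
    have "cor (\<alpha> \<circ> refl \<alpha>) = - cor \<alpha>"
      using root_coroot[OF \<alpha>] by (simp add: coroot_refl[OF \<alpha> \<alpha>]) (simp add: rrefl_def vec_eq_iff)
    then have "cor (\<lambda>X. - \<alpha> X) = - cor \<alpha>"
      by (simp add: comp_def refl_self[OF \<alpha>])
    then have "refl (\<lambda>X. - \<alpha> X) = refl \<alpha>"
      by (simp add: fun_eq_iff rrefl_def vec_eq_iff)
    then show ?thesis using refl_in_base_group[of "\<lambda>X. - \<alpha> X"] not_pos_iff[OF \<alpha>] False by simp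
  qed (rule refl_in_base_group)
  show "W \<subseteq> weyl_group D cor"
  proof
    fix w assume "w \<in> W"
    then show "w \<in> weyl_group D cor"
      by induction (blast intro: weyl_id weyl_group_comp refl)+
  qed
qed

section \<open>Words in simple reflections and the exchange property\<close>

definition word where "word l = foldr (\<lambda>\<alpha> w. refl \<alpha> \<circ> w) l id"

lemma word_simps [simp]: "word [] = id" "word (\<alpha> # l) = refl \<alpha> \<circ> word l"
  by (simp_all add: word_def)

lemma ex_word:
  assumes "w \<in> W" shows "\<exists>l. set l \<subseteq> D \<and> w = word l"
proof -
  have "w \<in> weyl_group D cor" using assms base_generates by simp
  then show ?thesis
  proof induction
    case weyl_id
    show ?case by (rule exI[of _ "[]"]) simp
  next
    case (weyl_step w \<alpha>)
    then obtain l where "set l \<subseteq> D" "w = word l" by blast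
    then show ?case using weyl_step(2) by (intro exI[of _ "\<alpha> # l"]) auto
  qed
qed

text \<open>Follow \<beta> along the word. A simple reflection permutes the positive roots other
  than its own, so positivity can only be lost at a letter equal to the current root. There the two
  reflections cancel; the letters before it are passed by conjugation.\<close>

lemma strong_exchange:
  assumes "set l \<subseteq> D" "\<beta> \<in> pos" "\<beta> \<circ> word l \<notin> pos"
  shows "\<exists>l'. set l' \<subseteq> D \<and> length l = Suc (length l') \<and> refl \<beta> \<circ> word l = word l'"
  using assms
proof (induction l arbitrary: \<beta>)
  case (Cons \<alpha> l)
  have \<alpha>: "\<alpha> \<in> D" "\<alpha> \<in> \<Phi>" using Cons base_root by auto
  show ?case
  proof (cases "\<beta> = \<alpha>")
    case True
    then show ?thesis
      using Cons(2) \<alpha> by (intro exI[of _ l]) (simp add: fun_eq_iff refl_refl)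
  next
    case False
    then have "\<beta> \<circ> refl \<alpha> \<in> pos" using base_refl_pos Cons \<alpha> by blast
    moreover have "(\<beta> \<circ> refl \<alpha>) \<circ> word l \<notin> pos" using Cons(4) by (simp add: comp_def)
    ultimately obtain l' where l': "set l' \<subseteq> D" "length l = Suc (length l')"
        "refl (\<beta> \<circ> refl \<alpha>) \<circ> word l = word l'"
      using Cons.IH[of "\<beta> \<circ> refl \<alpha>"] Cons(2) by (auto simp: comp_def)
    have "refl \<beta> \<circ> word (\<alpha> # l) = (refl \<beta> \<circ> refl \<alpha>) \<circ> word l" by (simp add: comp_def)
    also have "\<dots> = (refl \<alpha> \<circ> refl (\<beta> \<circ> refl \<alpha>)) \<circ> word l"
      using refl_W_commute[OF weyl_group_refl[where \<Psi>=\<Phi>, OF \<alpha>(2)] pos_root[OF Cons(3)]] by simp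
    also have "\<dots> = word (\<alpha> # l')" using l'(3) by (simp add: fun_eq_iff)
    finally show ?thesis using l' \<alpha> by (intro exI[of _ "\<alpha> # l'"]) (auto simp: comp_def)
  qed
qed simp

text \<open>Split off the first letter \<alpha> and let k be the rest. If \<alpha> \<circ> k is
  negative, exchange shortens the word. Otherwise dominance gives both \<alpha>(Z) and \<alpha>(k Z)
  = - \<alpha>(Z) nonnegative real part, so \<alpha> vanishes at \<open>Z\<close> and the letter can
  be stripped. Invariance of \<open>Z\<close> is tested on roots only, which also serves the proof
  of faithfulness.\<close>

lemma word_fixator:
  assumes "set l \<subseteq> D"
    and dom: "\<And>\<alpha>. \<alpha> \<in> pos \<Longrightarrow> Re (\<alpha> Z) \<ge> 0"
    and wall: "\<And>\<alpha>. \<alpha> \<in> \<Phi> \<Longrightarrow> Re (\<alpha> Z) = 0 \<Longrightarrow> \<alpha> Z = 0"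
    and "\<And>\<alpha>. \<alpha> \<in> \<Phi> \<Longrightarrow> \<alpha> (word l Z) = \<alpha> Z"
  shows "word l \<in> weyl_group {\<alpha>\<in>\<Phi>. \<alpha> Z = 0} cor"
  using assms(1,4)
proof (induction "length l" arbitrary: l rule: less_induct)
  case less
  show ?case
  proof (cases l)
    case (Cons \<alpha> k)
    then have \<alpha>: "\<alpha> \<in> D" "\<alpha> \<in> \<Phi>" "\<alpha> \<in> pos" and k: "set k \<subseteq> D"
      using less base_root base_pos by auto
    show ?thesis
    proof (cases "\<alpha> \<circ> word k \<in> pos")
      case False
      then obtain l' where "set l' \<subseteq> D" "length k = Suc (length l')" "refl \<alpha> \<circ> word k = word l'"
        using strong_exchange[OF k \<alpha>(3)] by blast
      then show ?thesis using less.hyps[of l'] less.prems Cons by (simp add: comp_def)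
    next
      case True
      have inv: "\<beta> (word k Z) = \<beta> (refl \<alpha> Z)" if "\<beta> \<in> \<Phi>" for \<beta>
        using less.prems(2)[OF root_refl[OF \<alpha>(2) that]] by (simp add: Cons refl_refl \<alpha>)
      then have "\<alpha> (word k Z) = - \<alpha> Z" using \<alpha> refl_self by simp
      then have "Re (\<alpha> Z) = 0" using dom[OF True] dom[OF \<alpha>(3)] by simp
      then have z: "\<alpha> Z = 0" using wall \<alpha> by blast
      then have "refl \<alpha> Z = Z" by (simp add: rrefl_def)
      then have "word k \<in> weyl_group {\<alpha>\<in>\<Phi>. \<alpha> Z = 0} cor"
        using less.hyps[of k] k inv Cons by simp
      then show ?thesis using z \<alpha> Cons by (auto intro: weyl_step)
    qed
  qed (auto intro: weyl_id)
qed

end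

lemma dominant_fixator:
  assumes "w \<in> W"
    and "\<And>\<alpha>. \<alpha> \<in> pos \<Longrightarrow> Re (\<alpha> Z) \<ge> 0"
    and "\<And>\<alpha>. \<alpha> \<in> \<Phi> \<Longrightarrow> Re (\<alpha> Z) = 0 \<Longrightarrow> \<alpha> Z = 0"
    and "\<And>\<alpha>. \<alpha> \<in> \<Phi> \<Longrightarrow> \<alpha> (w Z) = \<alpha> Z"
  shows "w \<in> weyl_group {\<alpha>\<in>\<Phi>. \<alpha> Z = 0} cor"
proof -
  obtain D where D: "base D" using ex_base by blast
  then obtain l where "set l \<subseteq> D" "w = word l" using ex_word assms(1) by blast
  then show ?thesis using word_fixator[OF D, of l Z] assms by blast
qed

end

section \<open>Faithfulness on roots, finiteness and fixators\<close>

context root_datum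
begin

text \<open>A regular vector is dominant for the positive system it defines and lies on no wall, so
  the fixator argument puts \<open>w\<close> into the group generated by no reflections. Hence W
  embeds into the self-maps of \<Phi>, which gives its finiteness.\<close>

lemma W_faithful_on_roots:
  assumes "w \<in> W" "\<And>\<alpha>. \<alpha> \<in> \<Phi> \<Longrightarrow> \<alpha> \<circ> w = \<alpha>"
  shows "w = id"
proof -
  obtain Y where Y: "\<And>\<alpha>. \<alpha> \<in> \<Phi> \<Longrightarrow> Re (\<alpha> Y) \<noteq> 0" using ex_regular_vector by blast
  interpret positive_system \<Phi> cor Y by unfold_locales (rule Y)
  have "w \<in> weyl_group {\<alpha>\<in>\<Phi>. \<alpha> Y = 0} cor"
    using assms Y by (intro dominant_fixator) (auto simp: pos_def fun_eq_iff)
  moreover have "{\<alpha>\<in>\<Phi>. \<alpha> Y = 0} = {}" using Y by force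
  ultimately show ?thesis using weyl_group_empty[of cor] by simp
qed

lemma finite_W: "finite W"
proof (rule inj_on_finite)
  show "inj_on (\<lambda>w. restrict (\<lambda>\<alpha>. \<alpha> \<circ> w) \<Phi>) W"
  proof (rule inj_onI)
    fix w v assume w: "w \<in> W" and v: "v \<in> W"
      and eq: "restrict (\<lambda>\<alpha>. \<alpha> \<circ> w) \<Phi> = restrict (\<lambda>\<alpha>. \<alpha> \<circ> v) \<Phi>"
    obtain u where u: "u \<in> W" "u \<circ> v = id" "v \<circ> u = id" using W_inverse[OF v] by blast
    have "\<alpha> \<circ> (w \<circ> u) = \<alpha>" if "\<alpha> \<in> \<Phi>" for \<alpha>
    proof -
      have "\<alpha> \<circ> w = \<alpha> \<circ> v" using fun_cong[OF eq, of \<alpha>] that by simp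
      then have "\<alpha> \<circ> w \<circ> u = \<alpha> \<circ> (v \<circ> u)" by (simp add: comp_assoc)
      then show ?thesis using u by (simp add: comp_assoc)
    qed
    then have "w \<circ> u = id" using W_faithful_on_roots weyl_group_comp[OF w u(1)] by blast
    then have "w \<circ> (u \<circ> v) = v" by (simp flip: comp_assoc)
    then show "w = v" using u by simp
  qed
  show "(\<lambda>w. restrict (\<lambda>\<alpha>. \<alpha> \<circ> w) \<Phi>) ` W \<subseteq> PiE \<Phi> (\<lambda>_. \<Phi>)"
    using W_root by auto
  show "finite (PiE \<Phi> (\<lambda>_. \<Phi>))" using finite_roots by (simp add: finite_PiE)
qed

theorem pointwise_fixator:
  assumes w: "w \<in> W" and fixed: "\<And>x. x \<in> T \<Longrightarrow> w x = x"
  shows "w \<in> weyl_group {\<alpha>\<in>\<Phi>. \<forall>x\<in>T. \<alpha> x = 0} cor"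
proof -
  define \<Psi> where "\<Psi> = {\<alpha>\<in>\<Phi>. \<forall>x\<in>T. \<alpha> x = 0}"
  \<comment> \<open>\<open>S\<close> contains \<open>T\<close>, is fixed pointwise by
    \<open>w\<close> and is closed under complex scalars; a point of \<open>S\<close> generic for
    the roots outside \<Psi> can replace the whole set \<open>T\<close>.\<close>
  define S where "S = {x. w x = x \<and> (\<forall>\<alpha>\<in>\<Psi>. \<alpha> x = 0)}"
  have clin: "\<alpha> (x + y) = \<alpha> x + \<alpha> y \<and> \<alpha> (c *s x) = c * \<alpha> x \<and> \<alpha> 0 = 0"
    if "\<alpha> \<in> \<Psi>" for \<alpha> x y c
    using that clin_funD[OF root_clin] by (auto simp: \<Psi>_def)
  have scale: "c *s x \<in> S" if "x \<in> S" for c x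
    using that W_linear[OF w] by (auto simp: S_def clin)
  have "\<exists>Z\<in>S. \<forall>f\<in>(\<lambda>\<alpha> x. Re (\<alpha> x)) ` (\<Phi> - \<Psi>). f Z \<noteq> 0"
  proof (rule ex_nonvanishing_vector)
    show "0 \<in> S" using W_linear(2)[OF w, of 0 0] by (auto simp: S_def clin)
    show "x + y \<in> S" if "x \<in> S" "y \<in> S" for x y
      using that W_linear[OF w] by (auto simp: S_def clin)
    show "r *\<^sub>R x \<in> S" if "x \<in> S" for r x
      using scale[OF that, of "of_real r"] by (simp add: of_real_vector_scalar_mult)
    fix f assume "f \<in> (\<lambda>\<alpha> x. Re (\<alpha> x)) ` (\<Phi> - \<Psi>)"
    then obtain \<alpha> where \<alpha>: "\<alpha> \<in> \<Phi>" "\<alpha> \<notin> \<Psi>" "f = (\<lambda>x. Re (\<alpha> x))" by blast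
    then obtain x where x: "x \<in> T" "\<alpha> x \<noteq> 0" by (auto simp: \<Psi>_def)
    have xS: "x \<in> S" using x fixed by (auto simp: S_def \<Psi>_def)
    \<comment> \<open>The real part of \<alpha>(i x) is minus the imaginary part of \<alpha>(x), so
      a nonzero root value is detected at x or at i x.\<close>
    have "f x \<noteq> 0 \<or> f (\<i> *s x) \<noteq> 0"
      using x(2) clin_funD(2)[OF root_clin[OF \<alpha>(1)]] by (simp add: \<alpha> complex_eq_iff)
    then show "\<exists>v\<in>S. f v \<noteq> 0" using xS scale by blast
  qed (use finite_roots root_Re_linear in auto)
  then obtain Z where Z: "Z \<in> S" "\<And>\<alpha>. \<alpha> \<in> \<Phi> - \<Psi> \<Longrightarrow> Re (\<alpha> Z) \<noteq> 0" by auto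
  have \<Psi>: "{\<alpha>\<in>\<Phi>. \<alpha> Z = 0} = \<Psi>"
    using Z by (force simp: S_def \<Psi>_def)
  \<comment> \<open>\<open>Z\<close> may lie on walls, so it is tilted slightly towards a regular
    vector. For small e the roots outside \<Psi> keep the sign they have at \<open>Z\<close>, and
    those in \<Psi> take their sign from \<open>Y\<close>; thus Z + e Y is regular and
    \<open>Z\<close> is dominant for its positive system.\<close>
  obtain Y where Y: "\<And>\<alpha>. \<alpha> \<in> \<Phi> \<Longrightarrow> Re (\<alpha> Y) \<noteq> 0" using ex_regular_vector by blast
  have "\<forall>\<^sub>F e in at_right 0. \<forall>\<alpha>\<in>\<Phi> - \<Psi>. e * \<bar>Re (\<alpha> Y)\<bar> < \<bar>Re (\<alpha> Z)\<bar>"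
  proof (rule eventually_ball_finite)
    show "\<forall>\<alpha>\<in>\<Phi> - \<Psi>. \<forall>\<^sub>F e in at_right 0. e * \<bar>Re (\<alpha> Y)\<bar> < \<bar>Re (\<alpha> Z)\<bar>"
    proof
      fix \<alpha> assume "\<alpha> \<in> \<Phi> - \<Psi>"
      then have "0 * \<bar>Re (\<alpha> Y)\<bar> < \<bar>Re (\<alpha> Z)\<bar>" using Z by simp
      moreover have "((\<lambda>e. e * \<bar>Re (\<alpha> Y)\<bar>) \<longlongrightarrow> 0 * \<bar>Re (\<alpha> Y)\<bar>) (at_right 0)"
        by (intro tendsto_intros)
      ultimately show "\<forall>\<^sub>F e in at_right 0. e * \<bar>Re (\<alpha> Y)\<bar> < \<bar>Re (\<alpha> Z)\<bar>"
        using order_tendstoD(2) by blast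
    qed
  qed (use finite_roots in simp)
  then obtain e where e: "e > 0" "\<And>\<alpha>. \<alpha> \<in> \<Phi> - \<Psi> \<Longrightarrow> e * \<bar>Re (\<alpha> Y)\<bar> < \<bar>Re (\<alpha> Z)\<bar>"
    using eventually_happens[OF eventually_conj[OF eventually_at_right_less]] by force
  have Re: "Re (\<alpha> (Z + e *\<^sub>R Y)) = Re (\<alpha> Z) + e * Re (\<alpha> Y)" if "\<alpha> \<in> \<Phi>" for \<alpha>
    using linear_add[OF root_Re_linear[OF that]] linear_scale[OF root_Re_linear[OF that]] by simp
  interpret positive_system \<Phi> cor "Z + e *\<^sub>R Y"
  proof
    fix \<alpha> assume \<alpha>: "\<alpha> \<in> \<Phi>"
    show "Re (\<alpha> (Z + e *\<^sub>R Y)) \<noteq> 0"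
    proof (cases "\<alpha> \<in> \<Psi>")
      case True
      then show ?thesis using Re[OF \<alpha>] Z(1) Y[OF \<alpha>] e(1) by (auto simp: S_def)
    next
      case False
      then show ?thesis using Re[OF \<alpha>] e(2)[of \<alpha>] e(1) \<alpha> abs_mult[of e "Re (\<alpha> Y)"] by auto
    qed
  qed
  have "w \<in> weyl_group {\<alpha>\<in>\<Phi>. \<alpha> Z = 0} cor"
  proof (rule dominant_fixator[OF w])
    show "\<alpha> (w Z) = \<alpha> Z" for \<alpha> using Z by (simp add: S_def)
    show "\<alpha> Z = 0" if "\<alpha> \<in> \<Phi>" "Re (\<alpha> Z) = 0" for \<alpha> using that Z \<Psi> by blast
    show "0 \<le> Re (\<alpha> Z)" if \<alpha>: "\<alpha> \<in> pos" for \<alpha>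
    proof (cases "\<alpha> \<in> \<Psi>")
      case True
      then show ?thesis using Z(1) by (auto simp: S_def)
    next
      case False
      have "0 < Re (\<alpha> Z) + e * Re (\<alpha> Y)" using \<alpha> Re by (auto simp: pos_def)
      then show ?thesis
        using e(2)[of \<alpha>] e(1) False pos_root[OF \<alpha>] abs_mult[of e "Re (\<alpha> Y)"] by auto
    qed
  qed
  then show ?thesis using \<Psi> by (simp add: \<Psi>_def)
qed

end

section \<open>Lifting in covering spaces and loop classes\<close>

abbreviation unit_square :: "(real \<times> real) set" where "unit_square \<equiv> {0..1} \<times> {0..1}"

lemma openin_quotient_top:
  "openin (quotient_top X f) U \<longleftrightarrow> U \<subseteq> f ` topspace X \<and> openin X {x\<in>topspace X. f x \<in> U}"
proof -
  have "istopology (\<lambda>U. U \<subseteq> f ` topspace X \<and> openin X {x\<in>topspace X. f x \<in> U})"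
    unfolding istopology_def
  proof (intro conjI allI impI)
    fix S T
    assume "S \<subseteq> f ` topspace X \<and> openin X {x\<in>topspace X. f x \<in> S}"
      and "T \<subseteq> f ` topspace X \<and> openin X {x\<in>topspace X. f x \<in> T}"
    moreover have "{x\<in>topspace X. f x \<in> S \<inter> T} = {x\<in>topspace X. f x \<in> S} \<inter> {x\<in>topspace X. f x \<in> T}"
      by auto
    ultimately show "S \<inter> T \<subseteq> f ` topspace X" "openin X {x\<in>topspace X. f x \<in> S \<inter> T}"
      by auto
  next
    fix K assume K: "\<forall>S\<in>K. S \<subseteq> f ` topspace X \<and> openin X {x\<in>topspace X. f x \<in> S}"
    moreover have "{x\<in>topspace X. f x \<in> \<Union>K} = (\<Union>S\<in>K. {x\<in>topspace X. f x \<in> S})" by auto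
    ultimately show "\<Union>K \<subseteq> f ` topspace X" "openin X {x\<in>topspace X. f x \<in> \<Union>K}"
      by (auto intro!: openin_Union)
  qed
  then show ?thesis by (simp add: quotient_top_def topology_inverse')
qed

lemma topspace_quotient_top: "topspace (quotient_top X f) = f ` topspace X"
proof -
  have "{x\<in>topspace X. f x \<in> f ` topspace X} = topspace X" by auto
  then have "openin (quotient_top X f) (f ` topspace X)" by (simp add: openin_quotient_top)
  then have "f ` topspace X \<subseteq> topspace (quotient_top X f)" by (rule openin_subset)
  moreover have "topspace (quotient_top X f) \<subseteq> f ` topspace X"
    using openin_topspace[of "quotient_top X f"] unfolding openin_quotient_top by blast
  ultimately show ?thesis by blast
qed

lemma quotient_map_quotient_top: "quotient_map X (quotient_top X f) f"
  unfolding quotient_map_def topspace_quotient_top openin_quotient_top by auto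

lemma continuous_map_in_topspace: "continuous_map X Y f \<Longrightarrow> x \<in> topspace X \<Longrightarrow> f x \<in> topspace Y"
  using continuous_map_funspace by fastforce

lemma continuous_map_closed_cases:
  assumes "closedin X A" "closedin X B" "topspace X \<subseteq> A \<union> B"
    and f: "continuous_map (subtopology X A) Y f" and g: "continuous_map (subtopology X B) Y g"
    and eq: "\<And>x. x \<in> A \<Longrightarrow> x \<in> B \<Longrightarrow> f x = g x"
  shows "continuous_map X Y (\<lambda>x. if x \<in> A then f x else g x)"
  unfolding continuous_map_closedin
proof (intro conjI allI impI)
  show "(\<lambda>x. if x \<in> A then f x else g x) \<in> topspace X \<rightarrow> topspace Y"
    using continuous_map_in_topspace[OF f] continuous_map_in_topspace[OF g] assms(3) by auto
  fix C assume C: "closedin Y C"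
  have "closedin X {x \<in> topspace (subtopology X A). f x \<in> C}"
    using closedin_continuous_map_preimage[OF f C] closedin_trans_full assms(1) by blast
  moreover have "closedin X {x \<in> topspace (subtopology X B). g x \<in> C}"
    using closedin_continuous_map_preimage[OF g C] closedin_trans_full assms(2) by blast
  moreover have "{x \<in> topspace X. (if x \<in> A then f x else g x) \<in> C}
      = {x \<in> topspace (subtopology X A). f x \<in> C} \<union> {x \<in> topspace (subtopology X B). g x \<in> C}"
    using assms(3) eq by (auto split: if_splits)
  ultimately show "closedin X {x \<in> topspace X. (if x \<in> A then f x else g x) \<in> C}"
    by (simp add: closedin_Un)
qed

section \<open>Covering maps: uniqueness and existence of lifts\<close>

lemma covering_mapE:
  assumes "covering_map E Y p" "y \<in> topspace Y"
  obtains T v where "y \<in> T" "openin Y T" "\<Union>v = {x\<in>topspace E. p x \<in> T}"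
    "\<And>u. u \<in> v \<Longrightarrow> openin E u" "pairwise disjnt v"
    "\<And>u. u \<in> v \<Longrightarrow> homeomorphic_map (subtopology E u) (subtopology Y T) p"
proof -
  have "\<exists>T. y \<in> T \<and> openin Y T \<and>
        (\<exists>v. \<Union>v = {x\<in>topspace E. p x \<in> T} \<and> (\<forall>u\<in>v. openin E u) \<and> pairwise disjnt v \<and>
             (\<forall>u\<in>v. homeomorphic_map (subtopology E u) (subtopology Y T) p))"
    using assms unfolding covering_map_def by blast
  then show thesis by (elim exE conjE) (rule that, auto)
qed

lemma covering_map_continuous: "covering_map E Y p \<Longrightarrow> continuous_map E Y p"
  by (simp add: covering_map_def)

text \<open>The set where the lifts agree is clopen. Near any point each lift stays in one sheet; on
  a common sheet \<open>p\<close> is injective, so they agree, and distinct sheets are disjoint, so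
  they differ.\<close>

lemma covering_lift_unique:
  assumes p: "covering_map E Y p" and Z: "connected_space Z"
    and g: "continuous_map Z E g" and h: "continuous_map Z E h"
    and eq: "\<And>z. z \<in> topspace Z \<Longrightarrow> p (g z) = p (h z)"
    and a: "a \<in> topspace Z" "g a = h a" and z: "z \<in> topspace Z"
  shows "g z = h z"
proof -
  let ?A = "{z\<in>topspace Z. g z = h z}"
  have gE: "g x \<in> topspace E" and hE: "h x \<in> topspace E" if "x \<in> topspace Z" for x
    using continuous_map_in_topspace[OF g] continuous_map_in_topspace[OF h] that by auto
  have local: "\<exists>N. openin Z N \<and> x \<in> N \<and> ((\<forall>z\<in>N. g z = h z) \<or> (\<forall>z\<in>N. g z \<noteq> h z))"
    if x: "x \<in> topspace Z" for x
  proof -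
    have "p (g x) \<in> topspace Y"
      using continuous_map_in_topspace[OF covering_map_continuous[OF p]] gE[OF x] by auto
    then obtain T v where T: "p (g x) \<in> T" "\<Union>v = {x\<in>topspace E. p x \<in> T}"
      and op: "\<And>u. u \<in> v \<Longrightarrow> openin E u" and dis: "pairwise disjnt v"
      and homeo: "\<And>u. u \<in> v \<Longrightarrow> homeomorphic_map (subtopology E u) (subtopology Y T) p"
      by (rule covering_mapE[OF p]) blast
    have "g x \<in> \<Union>v" "h x \<in> \<Union>v" using T gE hE x eq[OF x] by auto
    then obtain u u' where u: "u \<in> v" "g x \<in> u" and u': "u' \<in> v" "h x \<in> u'" by blast
    define N where "N = {z\<in>topspace Z. g z \<in> u} \<inter> {z\<in>topspace Z. h z \<in> u'}"
    have N: "openin Z N"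
      unfolding N_def
      by (intro openin_Int openin_continuous_map_preimage[OF g] openin_continuous_map_preimage[OF h] op u u')
    have "(\<forall>z\<in>N. g z = h z) \<or> (\<forall>z\<in>N. g z \<noteq> h z)"
    proof (cases "u = u'")
      case True
      have "inj_on p (topspace E \<inter> u)"
        using homeo[OF u(1)] by (simp add: homeomorphic_eq_everything_map)
      then have "\<forall>z\<in>N. g z = h z"
        using eq True gE hE by (auto simp: N_def inj_on_def)
      then show ?thesis by blast
    next
      case False
      then have "disjnt u u'" using dis u u' by (simp add: pairwise_def)
      then have "\<forall>z\<in>N. g z \<noteq> h z" by (auto simp: N_def disjnt_iff)
      then show ?thesis by blast
    qed
    then show ?thesis using N u u' x by (intro exI[of _ N]) (auto simp: N_def)
  qed
  have "openin Z ?A"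
  proof (subst openin_subopen, intro ballI)
    fix x assume x: "x \<in> ?A"
    then obtain N where "openin Z N" "x \<in> N" "(\<forall>z\<in>N. g z = h z) \<or> (\<forall>z\<in>N. g z \<noteq> h z)"
      using local by blast
    then show "\<exists>T. openin Z T \<and> x \<in> T \<and> T \<subseteq> ?A"
      using x openin_subset by (intro exI[of _ N]) blast
  qed
  moreover have "openin Z (topspace Z - ?A)"
  proof (subst openin_subopen, intro ballI)
    fix x assume x: "x \<in> topspace Z - ?A"
    then obtain N where "openin Z N" "x \<in> N" "(\<forall>z\<in>N. g z = h z) \<or> (\<forall>z\<in>N. g z \<noteq> h z)"
      using local by blast
    then show "\<exists>T. openin Z T \<and> x \<in> T \<and> T \<subseteq> topspace Z - ?A"
      using x openin_subset by (intro exI[of _ N]) blast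
  qed
  then have "closedin Z ?A" by (auto simp: closedin_def)
  ultimately have "?A = {} \<or> ?A = topspace Z"
    using Z unfolding connected_space_clopen_in by blast
  then show ?thesis using a z by blast
qed

text \<open>Allowing every starting point above the lower left corner makes the property pass to
  adjacent rectangles: the second lift starts where the first one has arrived.\<close>

definition rect_liftable ::
  "'a topology \<Rightarrow> ('a \<Rightarrow> 'b) \<Rightarrow> (real \<times> real \<Rightarrow> 'b) \<Rightarrow> real \<Rightarrow> real \<Rightarrow> real \<Rightarrow> real \<Rightarrow> bool" where
  "rect_liftable E p F a b c d \<longleftrightarrow> (\<forall>e\<in>topspace E. p e = F (a, c) \<longrightarrow>
     (\<exists>G. continuous_map (top_of_set ({a..b} \<times> {c..d})) E G \<and>
          (\<forall>z\<in>{a..b} \<times> {c..d}. p (G z) = F z) \<and> G (a, c) = e))"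

text \<open>On a connected overlap, agreement at one point forces agreement everywhere, which is the
  compatibility that pasting along closed sets requires.\<close>

lemma covering_lift_glue:
  assumes p: "covering_map E Y p"
    and closed: "closed R" "closed S" and conn: "connected (R \<inter> S)" and k: "k \<in> R \<inter> S"
    and G: "continuous_map (top_of_set R) E G" "\<And>z. z \<in> R \<Longrightarrow> p (G z) = F z"
    and H: "continuous_map (top_of_set S) E H" "\<And>z. z \<in> S \<Longrightarrow> p (H z) = F z"
    and GH: "G k = H k"
  shows "\<exists>K. continuous_map (top_of_set (R \<union> S)) E K \<and> (\<forall>z\<in>R \<union> S. p (K z) = F z) \<and> (\<forall>z\<in>R. K z = G z)"
proof -
  have eq: "G z = H z" if "z \<in> R" "z \<in> S" for z
  proof (rule covering_lift_unique[OF p, of "top_of_set (R \<inter> S)"])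
    show "connected_space (top_of_set (R \<inter> S))"
      using conn by (simp add: connected_space_subtopology connectedin_iff_connected)
    show "continuous_map (top_of_set (R \<inter> S)) E G" "continuous_map (top_of_set (R \<inter> S)) E H"
      using G(1) H(1) continuous_map_from_subtopology_mono by blast+
  qed (use that k GH G(2) H(2) in auto)
  let ?K = "\<lambda>z. if z \<in> R then G z else H z"
  have "continuous_map (top_of_set (R \<union> S)) E ?K"
  proof (rule continuous_map_closed_cases[of _ R S])
    show "closedin (top_of_set (R \<union> S)) R" "closedin (top_of_set (R \<union> S)) S"
      using closed by (auto intro!: closed_subset)
    show "continuous_map (subtopology (top_of_set (R \<union> S)) R) E G"
      "continuous_map (subtopology (top_of_set (R \<union> S)) S) E H"
      using G(1) H(1) by (simp_all add: subtopology_subtopology Int_absorb1)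
  qed (use eq in auto)
  then show ?thesis using G(2) H(2) by (intro exI[of _ ?K]) auto
qed

lemma rect_liftable_horizontal:
  assumes p: "covering_map E Y p" and le: "a \<le> b" "b \<le> b'" "c \<le> d"
    and l: "rect_liftable E p F a b c d" "rect_liftable E p F b b' c d"
  shows "rect_liftable E p F a b' c d"
  unfolding rect_liftable_def
proof (intro ballI impI)
  fix e assume e: "e \<in> topspace E" "p e = F (a, c)"
  let ?R = "{a..b} \<times> {c..d}" and ?S = "{b..b'} \<times> {c..d}"
  obtain G where G: "continuous_map (top_of_set ?R) E G" "\<forall>z\<in>?R. p (G z) = F z" "G (a, c) = e"
    using l(1) e unfolding rect_liftable_def by blast
  have bc: "(b, c) \<in> ?R" using le by auto
  then have "G (b, c) \<in> topspace E" using continuous_map_in_topspace[OF G(1)] by auto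
  then obtain H where H: "continuous_map (top_of_set ?S) E H" "\<forall>z\<in>?S. p (H z) = F z" "H (b, c) = G (b, c)"
    using l(2) G(2) bc unfolding rect_liftable_def by blast
  have un: "?R \<union> ?S = {a..b'} \<times> {c..d}" using le by auto
  have int: "?R \<inter> ?S = {b} \<times> {c..d}" using le by auto
  have "\<exists>K. continuous_map (top_of_set (?R \<union> ?S)) E K \<and> (\<forall>z\<in>?R \<union> ?S. p (K z) = F z) \<and> (\<forall>z\<in>?R. K z = G z)"
  proof (rule covering_lift_glue[OF p _ _ _ _ G(1) _ H(1)])
    show "connected (?R \<inter> ?S)" unfolding int by (intro connected_Times) auto
    show "(b, c) \<in> ?R \<inter> ?S" using le by auto
  qed (use G H in \<open>auto intro!: closed_Times\<close>)
  then show "\<exists>G. continuous_map (top_of_set ({a..b'} \<times> {c..d})) E G \<and>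
      (\<forall>z\<in>{a..b'} \<times> {c..d}. p (G z) = F z) \<and> G (a, c) = e"
    unfolding un using G(3) le by force
qed

lemma rect_liftable_vertical:
  assumes p: "covering_map E Y p" and le: "a \<le> b" "c \<le> d" "d \<le> d'"
    and l: "rect_liftable E p F a b c d" "rect_liftable E p F a b d d'"
  shows "rect_liftable E p F a b c d'"
  unfolding rect_liftable_def
proof (intro ballI impI)
  fix e assume e: "e \<in> topspace E" "p e = F (a, c)"
  let ?R = "{a..b} \<times> {c..d}" and ?S = "{a..b} \<times> {d..d'}"
  obtain G where G: "continuous_map (top_of_set ?R) E G" "\<forall>z\<in>?R. p (G z) = F z" "G (a, c) = e"
    using l(1) e unfolding rect_liftable_def by blast
  have ad: "(a, d) \<in> ?R" using le by auto
  then have "G (a, d) \<in> topspace E" using continuous_map_in_topspace[OF G(1)] by auto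
  then obtain H where H: "continuous_map (top_of_set ?S) E H" "\<forall>z\<in>?S. p (H z) = F z" "H (a, d) = G (a, d)"
    using l(2) G(2) ad unfolding rect_liftable_def by blast
  have un: "?R \<union> ?S = {a..b} \<times> {c..d'}" using le by auto
  have int: "?R \<inter> ?S = {a..b} \<times> {d}" using le by auto
  have "\<exists>K. continuous_map (top_of_set (?R \<union> ?S)) E K \<and> (\<forall>z\<in>?R \<union> ?S. p (K z) = F z) \<and> (\<forall>z\<in>?R. K z = G z)"
  proof (rule covering_lift_glue[OF p _ _ _ _ G(1) _ H(1)])
    show "connected (?R \<inter> ?S)" unfolding int by (intro connected_Times) auto
    show "(a, d) \<in> ?R \<inter> ?S" using le by auto
  qed (use G H in \<open>auto intro!: closed_Times\<close>)
  then show "\<exists>G. continuous_map (top_of_set ({a..b} \<times> {c..d'})) E G \<and>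
      (\<forall>z\<in>{a..b} \<times> {c..d'}. p (G z) = F z) \<and> G (a, c) = e"
    unfolding un using G(3) le by force
qed

text \<open>A small rectangle goes into an evenly covered set, and the inverse of the sheet through
  \<open>e\<close> lifts it. The radius is uniform in both directions so that the result provides
  the local hypothesis of \<open>Bolzano\<close> in each coordinate.\<close>

lemma rect_liftable_small:
  assumes p: "covering_map E Y p" and F: "continuous_map euclidean Y F"
  shows "\<exists>r>0. \<forall>a b c d. a \<le> x \<and> x \<le> b \<and> b - a < r \<and> c \<le> t \<and> t \<le> d \<and> d - c < r
           \<longrightarrow> rect_liftable E p F a b c d"
proof -
  have "F (x, t) \<in> topspace Y" using continuous_map_in_topspace[OF F] by auto
  then obtain T v where T: "F (x, t) \<in> T" "openin Y T" "\<Union>v = {x\<in>topspace E. p x \<in> T}"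
      "\<And>u. u \<in> v \<Longrightarrow> openin E u" "pairwise disjnt v"
    and homeo: "\<And>u. u \<in> v \<Longrightarrow> homeomorphic_map (subtopology E u) (subtopology Y T) p"
    by (rule covering_mapE[OF p]) (rule that)
  have "open {z. F z \<in> T}"
    using openin_continuous_map_preimage[OF F T(2)] by simp
  then obtain r where r: "r > 0" "\<And>z. dist z (x, t) < r \<Longrightarrow> F z \<in> T"
    using T(1) unfolding open_dist by blast
  have "rect_liftable E p F a b c d"
    \<comment> \<open>Halving \<open>r\<close> bounds the distance to (x, t) by the sum of the two
      coordinate differences.\<close>
    if le: "a \<le> x" "x \<le> b" "b - a < r/2" "c \<le> t" "t \<le> d" "d - c < r/2" for a b c d
    unfolding rect_liftable_def
  proof (intro ballI impI)
    fix e assume e: "e \<in> topspace E" "p e = F (a, c)"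
    let ?R = "{a..b} \<times> {c..d}"
    have FT: "F z \<in> T" if "z \<in> ?R" for z
    proof (rule r(2))
      obtain s s' where z: "z = (s, s')" "a \<le> s" "s \<le> b" "c \<le> s'" "s' \<le> d" using \<open>z \<in> ?R\<close> by auto
      have "dist z (x, t) \<le> \<bar>s - x\<bar> + \<bar>s' - t\<bar>"
        unfolding z dist_Pair_Pair dist_real_def
        using sqrt_sum_squares_le_sum_abs by auto
      then show "dist z (x, t) < r" using z le by linarith
    qed
    have "(a, c) \<in> ?R" using le by auto
    then have "e \<in> \<Union>v" using T e FT by auto
    then obtain u where u: "u \<in> v" "e \<in> u" by blast
    obtain k where k: "continuous_map (subtopology Y T) (subtopology E u) k"
      "\<And>x. x \<in> topspace (subtopology E u) \<Longrightarrow> k (p x) = x"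
      "\<And>y. y \<in> topspace (subtopology Y T) \<Longrightarrow> p (k y) = y"
      using homeo[OF u(1)] unfolding homeomorphic_map_maps homeomorphic_maps_def by blast
    have "continuous_map (top_of_set ?R) (subtopology Y T) F"
      using FT F by (auto simp: continuous_map_in_subtopology continuous_map_from_subtopology)
    then have "continuous_map (top_of_set ?R) (subtopology E u) (k \<circ> F)"
      using k(1) continuous_map_compose by blast
    then have "continuous_map (top_of_set ?R) E (k \<circ> F)"
      using continuous_map_into_fulltopology by blast
    moreover have "p (k (F z)) = F z" if "z \<in> ?R" for z
      using k(3)[of "F z"] FT[OF that] openin_subset[OF T(2)] by auto
    moreover have "k (F (a, c)) = e" using k(2)[of e] e u by simp
    ultimately show "\<exists>G. continuous_map (top_of_set ?R) E G \<and> (\<forall>z\<in>?R. p (G z) = F z) \<and> G (a, c) = e"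
      by (intro exI[of _ "k \<circ> F"]) auto
  qed
  then show ?thesis using r(1) by (intro exI[of _ "r/2"]) auto
qed

text \<open>Bisection is used twice: in the second coordinate it produces liftable strips of full
  height around each \<open>x\<close>, with the smaller of two widths surviving a union; in the
  first coordinate it joins these strips.\<close>

lemma covering_lift_square:
  assumes p: "covering_map E Y p"
    and F: "continuous_map (top_of_set unit_square) Y F"
    and e: "e \<in> topspace E" "p e = F (0, 0)"
  obtains G where "continuous_map (top_of_set unit_square) E G"
    "\<And>s t. s \<in> {0..1} \<Longrightarrow> t \<in> {0..1} \<Longrightarrow> p (G (s, t)) = F (s, t)" "G (0, 0) = e"
proof -
  \<comment> \<open>Clamping to the square extends \<open>F\<close> to the whole plane, so that
    rectangles near the boundary need no special treatment.\<close>
  define cl :: "real \<times> real \<Rightarrow> real \<times> real" where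
    "cl = (\<lambda>z. (max 0 (min 1 (fst z)), max 0 (min 1 (snd z))))"
  have cl_eq: "cl (s, t) = (s, t)" if "s \<in> {0..1}" "t \<in> {0..1}" for s t
    using that by (auto simp: cl_def)
  have "continuous_on UNIV cl"
    unfolding cl_def by (intro continuous_intros)
  then have "continuous_map euclidean (top_of_set unit_square) cl"
    by (auto simp: continuous_map_in_subtopology cl_def)
  then have F': "continuous_map euclidean Y (F \<circ> cl)"
    using F continuous_map_compose by blast
  have strip: "\<exists>r>0. \<forall>a b. a \<le> x \<and> x \<le> b \<and> b - a < r \<longrightarrow> rect_liftable E p (F \<circ> cl) a b 0 1" for x
  proof (rule Bolzano[where P="\<lambda>c d. \<exists>r>0. \<forall>a b. a \<le> x \<and> x \<le> b \<and> b - a < r \<longrightarrow> rect_liftable E p (F \<circ> cl) a b c d"])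
    fix c d d' :: real
    assume *: "\<exists>r>0. \<forall>a b. a \<le> x \<and> x \<le> b \<and> b - a < r \<longrightarrow> rect_liftable E p (F \<circ> cl) a b c d"
      "\<exists>r>0. \<forall>a b. a \<le> x \<and> x \<le> b \<and> b - a < r \<longrightarrow> rect_liftable E p (F \<circ> cl) a b d d'"
      and le: "c \<le> d" "d \<le> d'"
    obtain r r' where r: "r > 0" "\<forall>a b. a \<le> x \<and> x \<le> b \<and> b - a < r \<longrightarrow> rect_liftable E p (F \<circ> cl) a b c d"
      and r': "r' > 0" "\<forall>a b. a \<le> x \<and> x \<le> b \<and> b - a < r' \<longrightarrow> rect_liftable E p (F \<circ> cl) a b d d'"
      using * by blast
    have "rect_liftable E p (F \<circ> cl) a b c d'" if "a \<le> x" "x \<le> b" "b - a < min r r'" for a b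
      using rect_liftable_vertical[OF p _ le, of a b "F \<circ> cl"] r(2) r'(2) that by simp
    then show "\<exists>r>0. \<forall>a b. a \<le> x \<and> x \<le> b \<and> b - a < r \<longrightarrow> rect_liftable E p (F \<circ> cl) a b c d'"
      using r(1) r'(1) by (intro exI[of _ "min r r'"]) auto
  next
    fix t :: real
    obtain r where "r > 0" "\<forall>a b c d. a \<le> x \<and> x \<le> b \<and> b - a < r \<and> c \<le> t \<and> t \<le> d \<and> d - c < r
           \<longrightarrow> rect_liftable E p (F \<circ> cl) a b c d"
      using rect_liftable_small[OF p F', of x t] by blast
    then show "\<exists>r>0. \<forall>c d. c \<le> t \<and> t \<le> d \<and> d - c < r \<longrightarrow>
        (\<exists>r>0. \<forall>a b. a \<le> x \<and> x \<le> b \<and> b - a < r \<longrightarrow> rect_liftable E p (F \<circ> cl) a b c d)"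
      by blast
  qed simp
  have "rect_liftable E p (F \<circ> cl) 0 1 0 1"
  proof (rule Bolzano[where P="\<lambda>a b. rect_liftable E p (F \<circ> cl) a b 0 1"])
    show "rect_liftable E p (F \<circ> cl) a c 0 1"
      if "rect_liftable E p (F \<circ> cl) a b 0 1" "rect_liftable E p (F \<circ> cl) b c 0 1" "a \<le> b" "b \<le> c" for a b c
      using rect_liftable_horizontal[OF p that(3,4) _ that(1,2)] by simp
  qed (use strip in auto)
  moreover have "p e = (F \<circ> cl) (0, 0)" using e(2) cl_eq[of 0 0] by simp
  ultimately obtain G where G: "continuous_map (top_of_set unit_square) E G"
      "\<forall>z\<in>unit_square. p (G z) = (F \<circ> cl) z" "G (0, 0) = e"
    using e(1) unfolding rect_liftable_def by blast
  show thesis by (rule that[OF G(1) _ G(3)]) (use G(2) cl_eq in auto)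
qed

lemma continuous_map_square_slice:
  assumes "continuous_map (top_of_set unit_square) X H" "s \<in> {0..1}"
  shows "pathin X (\<lambda>t. H (s, t))" "pathin X (\<lambda>t. H (t, s))"
proof -
  have "continuous_map (top_of_set {0..1}) (top_of_set unit_square) (\<lambda>t. (s, t))"
    "continuous_map (top_of_set {0..1}) (top_of_set unit_square) (\<lambda>t. (t, s))"
    using assms(2) by (auto simp: continuous_map_in_subtopology intro!: continuous_intros)
  then show "pathin X (\<lambda>t. H (s, t))" "pathin X (\<lambda>t. H (t, s))"
    using continuous_map_compose[OF _ assms(1)] unfolding pathin_def comp_def by blast+
qed

lemma continuous_map_square_reparam:
  assumes "continuous_map (top_of_set unit_square) X H"
    and "continuous_on S f" "f ` S \<subseteq> unit_square"
  shows "continuous_map (top_of_set S) X (\<lambda>z. H (f z))"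
proof -
  have "continuous_map (top_of_set S) (top_of_set unit_square) f"
    using assms(2,3) by (auto simp: continuous_map_in_subtopology)
  then show ?thesis using continuous_map_compose[OF _ assms(1)] unfolding comp_def by blast
qed

text \<open>A path is regarded as a square constant in the first coordinate, and an edge of the
  lifted square is the lifted path.\<close>

lemma covering_path_lift:
  assumes p: "covering_map E Y p" and \<gamma>: "pathin Y \<gamma>" and e: "e \<in> topspace E" "p e = \<gamma> 0"
  obtains \<delta> where "pathin E \<delta>" "\<And>t. t \<in> {0..1} \<Longrightarrow> p (\<delta> t) = \<gamma> t" "\<delta> 0 = e"
proof -
  have "continuous_map (top_of_set unit_square) (top_of_set {0..1}) (snd :: real \<times> real \<Rightarrow> real)"
    by (auto simp: continuous_map_in_subtopology intro!: continuous_intros)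
  then have "continuous_map (top_of_set unit_square) Y (\<gamma> \<circ> (snd :: real \<times> real \<Rightarrow> real))"
    using \<gamma> continuous_map_compose unfolding pathin_def by blast
  then obtain G where G: "continuous_map (top_of_set unit_square) E G"
    "\<And>s t. s \<in> {0..1} \<Longrightarrow> t \<in> {0..1} \<Longrightarrow> p (G (s, t)) = (\<gamma> \<circ> snd) (s, t)" "G (0, 0) = e"
    using covering_lift_square[OF p _ e(1)] e(2) by (metis comp_apply snd_conv)
  show thesis
    by (rule that[of "\<lambda>t. G (0, t)"]) (use continuous_map_square_slice[OF G(1)] G in auto)
qed

lemma covering_path_lift_unique:
  assumes "covering_map E Y p" "pathin E \<delta>" "pathin E \<delta>'" "\<delta> 0 = \<delta>' 0"
    "\<And>t. t \<in> {0..1} \<Longrightarrow> p (\<delta> t) = p (\<delta>' t)" "t \<in> {0..1}"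
  shows "\<delta> t = \<delta>' t"
proof (rule covering_lift_unique[OF assms(1), of "top_of_set {0..1}" \<delta> \<delta>' 0])
  show "connected_space (top_of_set {0..1::real})"
    by (simp add: connected_space_subtopology connectedin_iff_connected)
qed (use assms in \<open>auto simp: pathin_def\<close>)

lemma pathin_topspace: "pathin X g \<Longrightarrow> t \<in> {0..1} \<Longrightarrow> g t \<in> topspace X"
  using continuous_map_in_topspace unfolding pathin_def by fastforce

text \<open>Lift the homotopy from the corner (0, 0). Uniqueness of path lifts identifies all four
  edges: the bottom is constant \<open>e\<close>, the sides are the given lifts, and the top is
  constant because its projection is.\<close>

lemma covering_homotopy_lift:
  assumes p: "covering_map E Y p" and h: "loop_homotopic Y y \<gamma> \<gamma>'"
    and \<delta>: "pathin E \<delta>" "\<And>t. t \<in> {0..1} \<Longrightarrow> p (\<delta> t) = \<gamma> t" "\<delta> 0 = e"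
    and \<delta>': "pathin E \<delta>'" "\<And>t. t \<in> {0..1} \<Longrightarrow> p (\<delta>' t) = \<gamma>' t" "\<delta>' 0 = e"
  shows "\<delta> 1 = \<delta>' 1" and "\<delta> 1 = e \<Longrightarrow> loop_homotopic E e \<delta> \<delta>'"
proof -
  obtain H where H: "continuous_map (top_of_set unit_square) Y H"
    "\<And>t. t \<in> {0..1} \<Longrightarrow> H (0, t) = \<gamma> t" "\<And>t. t \<in> {0..1} \<Longrightarrow> H (1, t) = \<gamma>' t"
    "\<And>s. s \<in> {0..1} \<Longrightarrow> H (s, 0) = y" "\<And>s. s \<in> {0..1} \<Longrightarrow> H (s, 1) = y"
    using h unfolding loop_homotopic_def prod_topology_subtopology_eu by blast
  have e: "e \<in> topspace E" using pathin_topspace[OF \<delta>(1), of 0] \<delta>(3) by simp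
  have "p e = H (0, 0)" using \<delta>(2)[of 0] \<delta>(3) H(2)[of 0] by simp
  then obtain G where G: "continuous_map (top_of_set unit_square) E G"
    "\<And>s t. s \<in> {0..1} \<Longrightarrow> t \<in> {0..1} \<Longrightarrow> p (G (s, t)) = H (s, t)" "G (0, 0) = e"
    using covering_lift_square[OF p H(1) e] by blast
  note slice = continuous_map_square_slice[OF G(1)]
  have const: "pathin E (\<lambda>t. x)" if "x \<in> topspace E" for x
    using that by (simp add: pathin_const)
  have bottom: "G (s, 0) = e" if "s \<in> {0..1}" for s
    by (rule covering_path_lift_unique[OF p slice(2)[of 0] const[OF e] _ _ that])
       (use G H \<delta>(2)[of 0] in \<open>auto simp: \<delta>\<close>)
  have left: "G (0, t) = \<delta> t" if "t \<in> {0..1}" for t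
    by (rule covering_path_lift_unique[OF p slice(1)[of 0] \<delta>(1) _ _ that]) (use G H \<delta> in auto)
  have right: "G (1, t) = \<delta>' t" if "t \<in> {0..1}" for t
    by (rule covering_path_lift_unique[OF p slice(1)[of 1] \<delta>'(1) _ _ that]) (use G H \<delta>' bottom in auto)
  have top: "G (s, 1) = \<delta> 1" if "s \<in> {0..1}" for s
  proof (rule covering_path_lift_unique[OF p slice(2)[of 1] const _ _ that])
    show "\<delta> 1 \<in> topspace E" using pathin_topspace[OF \<delta>(1), of 1] by simp
    show "p (G (t, 1)) = p (\<delta> 1)" if "t \<in> {0..1}" for t
      using G(2)[of t 1] H(2)[of 1] H(5)[of t] H(5)[of 0] \<delta>(2)[of 1] that by simp
  qed (use left in auto)
  show "\<delta> 1 = \<delta>' 1" using top[of 1] right[of 1] by simp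
  show "loop_homotopic E e \<delta> \<delta>'" if "\<delta> 1 = e"
    unfolding loop_homotopic_def prod_topology_subtopology_eu
    using G(1) bottom left right top that by (intro exI[of _ G]) auto
qed

section \<open>Joining squares and calculating with loop classes\<close>

lemma continuous_map_square_join:
  assumes H: "continuous_map (top_of_set unit_square) X H"
    and K: "continuous_map (top_of_set unit_square) X K"
    and eq: "\<And>s. s \<in> {0..1} \<Longrightarrow> H (s, 1) = K (s, 0)"
  shows "continuous_map (top_of_set unit_square) X
     (\<lambda>(s, t). if t \<le> 1/2 then H (s, 2 * t) else K (s, 2 * t - 1))"
proof -
  let ?A = "{0..1} \<times> {0..1/2::real} :: (real \<times> real) set" and ?B = "{0..1} \<times> {1/2..1::real} :: (real \<times> real) set"
  have "continuous_map (top_of_set unit_square) X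
     (\<lambda>z. if z \<in> ?A then H (fst z, 2 * snd z) else K (fst z, 2 * snd z - 1))"
  proof (rule continuous_map_closed_cases[where A="?A" and B="?B"])
    show "closedin (top_of_set unit_square) ?A" "closedin (top_of_set unit_square) ?B"
      by (auto intro!: closed_subset closed_Times)
    have sub: "?A \<subseteq> unit_square" "?B \<subseteq> unit_square" by auto
    show "continuous_map (subtopology (top_of_set unit_square) ?A) X (\<lambda>z. H (fst z, 2 * snd z))"
      unfolding subtopology_subtopology Int_absorb1[OF sub(1)]
      by (rule continuous_map_square_reparam[OF H]) (auto intro!: continuous_intros)
    show "continuous_map (subtopology (top_of_set unit_square) ?B) X (\<lambda>z. K (fst z, 2 * snd z - 1))"
      unfolding subtopology_subtopology Int_absorb1[OF sub(2)]
      by (rule continuous_map_square_reparam[OF K]) (auto intro!: continuous_intros)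
    fix z assume z: "z \<in> ?A" "z \<in> ?B"
    then have "2 * snd z = 1" "fst z \<in> {0..1}" by auto
    then show "H (fst z, 2 * snd z) = K (fst z, 2 * snd z - 1)" using eq[of "fst z"] by simp
  qed auto
  then show ?thesis by (rule continuous_map_eq) (auto split: if_splits)
qed

lemma continuous_map_square_swap:
  assumes "continuous_map (top_of_set unit_square) X H"
  shows "continuous_map (top_of_set unit_square) X (\<lambda>(s, t). H (t, s))"
  using continuous_map_square_reparam[OF assms, of "unit_square" "\<lambda>z. (snd z, fst z)"]
  by (force simp: case_prod_unfold intro: continuous_intros)

lemma pathin_loop_join:
  assumes "pathin X g" "pathin X h" "g 1 = h 0"
  shows "pathin X (loop_join g h)"
proof -
  have snd: "continuous_map (top_of_set unit_square) X (\<lambda>z :: real \<times> real. g (snd z))" if "pathin X g" for g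
  proof -
    have "continuous_map (top_of_set unit_square) (top_of_set {0..1}) (snd :: real \<times> real \<Rightarrow> real)"
      by (auto simp: continuous_map_in_subtopology intro!: continuous_intros)
    then show ?thesis
      using that continuous_map_compose unfolding pathin_def comp_def by blast
  qed
  have "pathin X (\<lambda>t. (\<lambda>(s, t). if t \<le> 1/2 then g (snd (s, 2 * t)) else h (snd (s, 2 * t - 1))) (0::real, t))"
    by (rule continuous_map_square_slice(1))
       (use continuous_map_square_join[OF snd[OF assms(1)] snd[OF assms(2)]] assms(3) in auto)
  then show ?thesis by (simp only: loop_join_def[abs_def] case_prod_conv snd_conv cong: if_cong)
qed

lemma loop_join_ends: "loop_join g h 0 = g 0" "loop_join g h 1 = h 1"
  by (simp_all add: loop_join_def)

lemma loop_join_in_loops: "g \<in> loops_at X x \<Longrightarrow> h \<in> loops_at X x \<Longrightarrow> loop_join g h \<in> loops_at X x"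
  by (simp add: loops_at_def pathin_loop_join loop_join_ends)

lemma loop_homotopic_refl:
  assumes "g \<in> loops_at X x" shows "loop_homotopic X x g g"
proof -
  have "continuous_map (top_of_set unit_square) (top_of_set {0..1}) (snd :: real \<times> real \<Rightarrow> real)"
    by (auto simp: continuous_map_in_subtopology intro!: continuous_intros)
  then have "continuous_map (top_of_set unit_square) X (g \<circ> (snd :: real \<times> real \<Rightarrow> real))"
    using assms continuous_map_compose unfolding pathin_def loops_at_def by blast
  then show ?thesis
    unfolding loop_homotopic_def prod_topology_subtopology_eu
    using assms by (intro exI[of _ "g \<circ> snd"]) (auto simp: loops_at_def)
qed

lemma loop_homotopic_sym:
  assumes "loop_homotopic X x g h" shows "loop_homotopic X x h g"
proof -
  obtain H where H: "continuous_map (top_of_set unit_square) X H"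
    "\<forall>t\<in>{0..1}. H (0, t) = g t \<and> H (1, t) = h t" "\<forall>s\<in>{0..1}. H (s, 0) = x \<and> H (s, 1) = x"
    using assms unfolding loop_homotopic_def prod_topology_subtopology_eu by blast
  have "continuous_map (top_of_set unit_square) X (\<lambda>z. H (1 - fst z, snd z))"
    by (rule continuous_map_square_reparam[OF H(1)]) (auto intro!: continuous_intros)
  then show ?thesis
    unfolding loop_homotopic_def prod_topology_subtopology_eu
    using H by (intro exI[of _ "\<lambda>z. H (1 - fst z, snd z)"]) auto
qed

lemma loop_homotopic_trans:
  assumes "loop_homotopic X x g h" "loop_homotopic X x h k" shows "loop_homotopic X x g k"
proof -
  obtain H where H: "continuous_map (top_of_set unit_square) X H"
    "\<forall>t\<in>{0..1}. H (0, t) = g t \<and> H (1, t) = h t" "\<forall>s\<in>{0..1}. H (s, 0) = x \<and> H (s, 1) = x"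
    using assms(1) unfolding loop_homotopic_def prod_topology_subtopology_eu by blast
  obtain K where K: "continuous_map (top_of_set unit_square) X K"
    "\<forall>t\<in>{0..1}. K (0, t) = h t \<and> K (1, t) = k t" "\<forall>s\<in>{0..1}. K (s, 0) = x \<and> K (s, 1) = x"
    using assms(2) unfolding loop_homotopic_def prod_topology_subtopology_eu by blast
  \<comment> \<open>Stacking homotopies in the parameter \<open>s\<close> is joining in
    \<open>t\<close> conjugated by the exchange of coordinates.\<close>
  let ?L = "\<lambda>(s, t). (\<lambda>(s, t). if t \<le> 1/2 then (\<lambda>(s, t). H (t, s)) (s, 2 * t)
      else (\<lambda>(s, t). K (t, s)) (s, 2 * t - 1)) (t, s)"
  have "continuous_map (top_of_set unit_square) X ?L"
    by (intro continuous_map_square_swap continuous_map_square_join H(1) K(1)) (use H K in auto)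
  then show ?thesis
    unfolding loop_homotopic_def prod_topology_subtopology_eu
    using H(2,3) K(2,3) by (intro exI[of _ ?L]) auto
qed

lemma loop_homotopic_join:
  assumes "loop_homotopic X x g g'" "loop_homotopic X x h h'"
  shows "loop_homotopic X x (loop_join g h) (loop_join g' h')"
proof -
  obtain H where H: "continuous_map (top_of_set unit_square) X H"
    "\<forall>t\<in>{0..1}. H (0, t) = g t \<and> H (1, t) = g' t" "\<forall>s\<in>{0..1}. H (s, 0) = x \<and> H (s, 1) = x"
    using assms(1) unfolding loop_homotopic_def prod_topology_subtopology_eu by blast
  obtain K where K: "continuous_map (top_of_set unit_square) X K"
    "\<forall>t\<in>{0..1}. K (0, t) = h t \<and> K (1, t) = h' t" "\<forall>s\<in>{0..1}. K (s, 0) = x \<and> K (s, 1) = x"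
    using assms(2) unfolding loop_homotopic_def prod_topology_subtopology_eu by blast
  let ?L = "\<lambda>(s, t). if t \<le> 1/2 then H (s, 2 * t) else K (s, 2 * t - 1)"
  have "continuous_map (top_of_set unit_square) X ?L"
    by (intro continuous_map_square_join H(1) K(1)) (use H K in auto)
  then show ?thesis
    unfolding loop_homotopic_def prod_topology_subtopology_eu
    using H(2,3) K(2,3) by (intro exI[of _ ?L]) (auto simp: loop_join_def)
qed

lemma loop_homotopic_compose:
  assumes "loop_homotopic X x g h" "continuous_map X Y f"
  shows "loop_homotopic Y (f x) (f \<circ> g) (f \<circ> h)"
proof -
  obtain H where H: "continuous_map (top_of_set unit_square) X H"
    "\<forall>t\<in>{0..1}. H (0, t) = g t \<and> H (1, t) = h t" "\<forall>s\<in>{0..1}. H (s, 0) = x \<and> H (s, 1) = x"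
    using assms(1) unfolding loop_homotopic_def prod_topology_subtopology_eu by blast
  have "continuous_map (top_of_set unit_square) Y (f \<circ> H)"
    using continuous_map_compose[OF H(1) assms(2)] .
  then show ?thesis
    unfolding loop_homotopic_def prod_topology_subtopology_eu
    using H(2,3) by (intro exI[of _ "f \<circ> H"]) auto
qed

lemma loops_at_compose: "g \<in> loops_at X x \<Longrightarrow> continuous_map X Y f \<Longrightarrow> f \<circ> g \<in> loops_at Y (f x)"
  by (auto simp: loops_at_def pathin_compose)

lemma loop_class_eq_iff:
  assumes "g \<in> loops_at X x" "h \<in> loops_at X x"
  shows "loop_class X x g = loop_class X x h \<longleftrightarrow> loop_homotopic X x g h"
proof
  assume "loop_class X x g = loop_class X x h"
  moreover have "h \<in> loop_class X x h" using assms by (simp add: loop_class_def loop_homotopic_refl)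
  ultimately show "loop_homotopic X x g h" by (auto simp: loop_class_def)
next
  assume gh: "loop_homotopic X x g h"
  have "loop_homotopic X x g k \<longleftrightarrow> loop_homotopic X x h k" for k
    using loop_homotopic_trans[OF gh, of k] loop_homotopic_trans[OF loop_homotopic_sym[OF gh], of k]
    by blast
  then show "loop_class X x g = loop_class X x h" by (simp add: loop_class_def)
qed

lemma loop_class_some:
  assumes "g \<in> loops_at X x"
  shows "(SOME h. h \<in> loop_class X x g) \<in> loops_at X x"
    "loop_homotopic X x g (SOME h. h \<in> loop_class X x g)"
proof -
  have "g \<in> loop_class X x g" using assms by (simp add: loop_class_def loop_homotopic_refl)
  then have "(SOME h. h \<in> loop_class X x g) \<in> loop_class X x g"
    by (rule someI[of "\<lambda>h. h \<in> loop_class X x g"])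
  then show "(SOME h. h \<in> loop_class X x g) \<in> loops_at X x"
    "loop_homotopic X x g (SOME h. h \<in> loop_class X x g)"
    by (simp_all add: loop_class_def)
qed

lemma carrier_fundamental_group: "carrier (fundamental_group X x) = loop_class X x ` loops_at X x"
  by (simp add: fundamental_group_def)

text \<open>The product is defined through chosen representatives; compatibility of homotopy with
  joining removes the choice.\<close>

lemma fundamental_group_mult:
  assumes "g \<in> loops_at X x" "h \<in> loops_at X x"
  shows "loop_class X x g \<otimes>\<^bsub>fundamental_group X x\<^esub> loop_class X x h = loop_class X x (loop_join g h)"
proof -
  note g = loop_class_some[OF assms(1)] and h = loop_class_some[OF assms(2)]
  have "loop_homotopic X x (loop_join g h)
      (loop_join (SOME k. k \<in> loop_class X x g) (SOME k. k \<in> loop_class X x h))"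
    by (rule loop_homotopic_join) (use g h in auto)
  then have "loop_class X x (loop_join g h)
      = loop_class X x (loop_join (SOME k. k \<in> loop_class X x g) (SOME k. k \<in> loop_class X x h))"
    using loop_class_eq_iff[OF loop_join_in_loops[OF assms] loop_join_in_loops[OF g(1) h(1)]] by simp
  then show ?thesis by (simp add: fundamental_group_def)
qed

section \<open>Quotients by free finite actions\<close>

text \<open>Freeness is understood modulo the kernel: by \<open>act_free\<close> an element with one
  fixed point acts trivially, without being the unit. The flag stabiliser thus fits directly, and no
  action of a quotient group has to be constructed.\<close>

locale free_finite_action = group \<Gamma>
  for \<Gamma> :: "('g, 'm) monoid_scheme" (structure) +
  fixes E :: "'a topology" and Y :: "'b topology" and q :: "'a \<Rightarrow> 'b" and act :: "'g \<Rightarrow> 'a \<Rightarrow> 'a"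
  assumes finite_group: "finite (carrier \<Gamma>)"
    and Hausdorff: "Hausdorff_space E"
    and act_continuous: "g \<in> carrier \<Gamma> \<Longrightarrow> continuous_map E E (act g)"
    and act_mult: "g \<in> carrier \<Gamma> \<Longrightarrow> h \<in> carrier \<Gamma> \<Longrightarrow> x \<in> topspace E \<Longrightarrow> act (g \<otimes> h) x = act g (act h x)"
    and act_one: "x \<in> topspace E \<Longrightarrow> act \<one> x = x"
    and act_free: "g \<in> carrier \<Gamma> \<Longrightarrow> x \<in> topspace E \<Longrightarrow> act g x = x \<Longrightarrow> z \<in> topspace E \<Longrightarrow> act g z = z"
    and quotient: "quotient_map E Y q"
    and fibre: "x \<in> topspace E \<Longrightarrow> y \<in> topspace E \<Longrightarrow> q x = q y \<longleftrightarrow> (\<exists>g\<in>carrier \<Gamma>. y = act g x)"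
begin

lemma act_in: "g \<in> carrier \<Gamma> \<Longrightarrow> x \<in> topspace E \<Longrightarrow> act g x \<in> topspace E"
  using continuous_map_in_topspace[OF act_continuous] .

lemma act_inv:
  assumes "g \<in> carrier \<Gamma>" "x \<in> topspace E"
  shows "act (inv g) (act g x) = x" "act g (act (inv g) x) = x"
  using act_mult[of "inv g" g x] act_mult[of g "inv g" x] assms act_one by simp_all

lemma q_act: "g \<in> carrier \<Gamma> \<Longrightarrow> x \<in> topspace E \<Longrightarrow> q (act g x) = q x"
  using fibre[of x "act g x"] act_in by auto

lemma act_image_open:
  assumes g: "g \<in> carrier \<Gamma>" and N: "openin E N"
  shows "openin E (act g ` N)"
proof -
  have sub: "N \<subseteq> topspace E" using N openin_subset by blast
  have "act g ` N = {x\<in>topspace E. act (inv g) x \<in> N}"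
  proof (intro equalityI subsetI)
    fix x assume "x \<in> act g ` N"
    then show "x \<in> {x\<in>topspace E. act (inv g) x \<in> N}" using act_in act_inv g sub by auto
  next
    fix x assume "x \<in> {x\<in>topspace E. act (inv g) x \<in> N}"
    then show "x \<in> act g ` N" using act_inv(2)[OF g, of x] by (metis (no_types, lifting) image_eqI mem_Collect_eq)
  qed
  then show ?thesis
    using openin_continuous_map_preimage[OF act_continuous N, of "inv g"] g by simp
qed

lemma preimage_image_q:
  assumes N: "N \<subseteq> topspace E"
  shows "{x\<in>topspace E. q x \<in> q ` N} = (\<Union>g\<in>carrier \<Gamma>. act g ` N)"
proof (intro equalityI subsetI)
  fix x assume "x \<in> {x\<in>topspace E. q x \<in> q ` N}"
  then obtain y where "x \<in> topspace E" "y \<in> N" "q y = q x" by auto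
  then show "x \<in> (\<Union>g\<in>carrier \<Gamma>. act g ` N)" using fibre[of y x] N by blast
next
  fix x assume "x \<in> (\<Union>g\<in>carrier \<Gamma>. act g ` N)"
  then obtain g y where "g \<in> carrier \<Gamma>" "y \<in> N" "x = act g y" by blast
  then show "x \<in> {x\<in>topspace E. q x \<in> q ` N}" using act_in q_act N by auto
qed

text \<open>The preimage of the image of N is the union of the translates of N, each open because
  the inverse element acts continuously.\<close>

lemma q_open: "open_map E Y q"
  unfolding open_map_def
proof (intro allI impI)
  fix N assume N: "openin E N"
  then have sub: "N \<subseteq> topspace E" using openin_subset by blast
  have qN: "q ` N \<subseteq> topspace Y" using quotient_imp_surjective_map[OF quotient] sub by blast
  have "openin E {x\<in>topspace E. q x \<in> q ` N}"
    unfolding preimage_image_q[OF sub] using act_image_open N by auto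
  then show "openin Y (q ` N)"
    using quotient[unfolded quotient_map_def, THEN conjunct2, rule_format, OF qN] by simp
qed

text \<open>Each of the finitely many elements moving \<open>x\<close> is treated by Hausdorff
  separation of \<open>x\<close> from its image, and the neighbourhoods are intersected. Elements
  fixing \<open>x\<close> act trivially and need no separation.\<close>

lemma separating_nbhd:
  assumes x: "x \<in> topspace E"
  obtains N where "openin E N" "x \<in> N"
    "\<And>g. g \<in> carrier \<Gamma> \<Longrightarrow> act g x \<noteq> x \<Longrightarrow> act g ` N \<inter> N = {}"
proof -
  have "\<exists>U. openin E U \<and> x \<in> U \<and> act g ` U \<inter> U = {}"
    if g: "g \<in> carrier \<Gamma>" "act g x \<noteq> x" for g
  proof -
    obtain U V where UV: "openin E U" "openin E V" "x \<in> U" "act g x \<in> V" "disjnt U V"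
      using Hausdorff x act_in[OF g(1) x] g(2) unfolding Hausdorff_space_def by metis
    let ?N = "U \<inter> {z\<in>topspace E. act g z \<in> V}"
    have "openin E ?N"
      using UV openin_continuous_map_preimage[OF act_continuous[OF g(1)] UV(2)] by blast
    then show ?thesis using UV x by (intro exI[of _ ?N]) (auto simp: disjnt_iff)
  qed
  then obtain U where U: "\<And>g. g \<in> carrier \<Gamma> \<Longrightarrow> act g x \<noteq> x \<Longrightarrow>
      openin E (U g) \<and> x \<in> U g \<and> act g ` U g \<inter> U g = {}"
    by metis
  let ?I = "{g\<in>carrier \<Gamma>. act g x \<noteq> x}"
  let ?N = "(\<Inter>g\<in>?I. U g) \<inter> topspace E"
  show thesis
  proof (rule that[of ?N])
    show "openin E ?N" using U finite_group by (intro openin_INT) auto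
    show "x \<in> ?N" using U x by auto
    fix g assume g: "g \<in> carrier \<Gamma>" "act g x \<noteq> x"
    then have "?N \<subseteq> U g" by auto
    then show "act g ` ?N \<inter> ?N = {}" using U[OF g] by blast
  qed
qed

text \<open>The sheets over the image of a separating neighbourhood are its translates. Two
  translates that meet coincide, and an element relating two points of one sheet acts trivially,
  which gives injectivity.\<close>

lemma covering: "covering_map E Y q"
  unfolding covering_map_def
proof (intro conjI ballI)
  show "continuous_map E Y q" using quotient by (rule quotient_imp_continuous_map)
  show surj: "q ` topspace E = topspace Y" using quotient by (rule quotient_imp_surjective_map)
  fix y assume "y \<in> topspace Y"
  then obtain x where x: "x \<in> topspace E" "y = q x" using surj by blast
  obtain N where N: "openin E N" "x \<in> N"
      and sep: "\<And>g. g \<in> carrier \<Gamma> \<Longrightarrow> act g x \<noteq> x \<Longrightarrow> act g ` N \<inter> N = {}"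
    using separating_nbhd[OF x(1)] by metis
  have sub: "N \<subseteq> topspace E" using N openin_subset by blast
  \<comment> \<open>An element bringing some point of \<open>N\<close> back into \<open>N\<close>
    cannot move \<open>x\<close>, hence it acts trivially.\<close>
  have trivial: "act g z = z" if "g \<in> carrier \<Gamma>" "a \<in> N" "act g a \<in> N" "z \<in> topspace E" for g a z
    using sep[OF that(1)] act_free[OF that(1) x(1) _ that(4)] that(2,3) by blast
  have same: "act g z = act h z"
    if "g \<in> carrier \<Gamma>" "h \<in> carrier \<Gamma>" "a \<in> N" "b \<in> N" "act g a = act h b" "z \<in> topspace E" for g h a b z
  proof -
    have "act (inv h \<otimes> g) a = b"
      using that sub act_mult[of "inv h" g a] act_inv(1)[of h b] subsetD[OF sub] by simp
    then have "act (inv h \<otimes> g) z = z" using trivial[of "inv h \<otimes> g" a z] that by simp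
    then have "act h (act (inv h) (act g z)) = act h z"
      using act_mult[of "inv h" g z] that by simp
    then show ?thesis using act_inv(2)[of h "act g z"] act_in that by simp
  qed
  \<comment> \<open>A set of sets rather than a family over the group: translates by elements that
    act alike are counted once, as disjointness demands.\<close>
  let ?v = "(\<lambda>g. act g ` N) ` carrier \<Gamma>"
  have "pairwise disjnt ?v"
  proof (rule pairwiseI)
    fix u u' assume "u \<in> ?v" "u' \<in> ?v" "u \<noteq> u'"
    then obtain g h where gh: "g \<in> carrier \<Gamma>" "h \<in> carrier \<Gamma>" "u = act g ` N" "u' = act h ` N" by blast
    show "disjnt u u'"
    proof (rule ccontr)
      assume "\<not> disjnt u u'"
      then obtain a b where "a \<in> N" "b \<in> N" "act g a = act h b" using gh by (auto simp: disjnt_iff)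
      then have "act g z = act h z" if "z \<in> N" for z using same gh that sub by blast
      then show False using gh \<open>u \<noteq> u'\<close> by auto
    qed
  qed
  moreover have "homeomorphic_map (subtopology E (act g ` N)) (subtopology Y (q ` N)) q"
    if g: "g \<in> carrier \<Gamma>" for g
  proof (rule bijective_open_imp_homeomorphic_map)
    let ?u = "act g ` N"
    have qu: "q ` ?u = q ` N" unfolding image_image using q_act g sub by (intro image_cong) auto
    have usub: "?u \<subseteq> topspace E" using act_in g sub by auto
    have qN: "q ` N \<subseteq> topspace Y" using sub surj by blast
    show "continuous_map (subtopology E ?u) (subtopology Y (q ` N)) q"
      using quotient_imp_continuous_map[OF quotient] qu
      by (auto simp: continuous_map_in_subtopology continuous_map_from_subtopology)
    show "open_map (subtopology E ?u) (subtopology Y (q ` N)) q"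
      using open_map_from_subtopology[OF q_open act_image_open[OF g N(1)]] qu
      by (intro open_map_into_subtopology) auto
    show "q ` topspace (subtopology E ?u) = topspace (subtopology Y (q ` N))"
      using qu usub qN by (simp add: Int_absorb1)
    show "inj_on q (topspace (subtopology E ?u))"
    proof (rule inj_onI)
      fix a b assume "a \<in> topspace (subtopology E ?u)" "b \<in> topspace (subtopology E ?u)" "q a = q b"
      then obtain a' b' where ab: "a' \<in> N" "a = act g a'" "b' \<in> N" "b = act g b'" and "q a = q b"
        by auto
      moreover have "q a' = q b'"
        using \<open>q a = q b\<close> ab q_act[OF g] subsetD[OF sub] by simp
      ultimately obtain h where h: "h \<in> carrier \<Gamma>" "b' = act h a'" using fibre sub by blast
      then have "act h a' = a'" using trivial[of h a' a'] ab sub by auto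
      then show "a = b" using ab h by simp
    qed
  qed
  moreover have "openin Y (q ` N)" using q_open N unfolding open_map_def by blast
  ultimately show "\<exists>T. y \<in> T \<and> openin Y T \<and>
        (\<exists>v. \<Union>v = {x\<in>topspace E. q x \<in> T} \<and> (\<forall>u\<in>v. openin E u) \<and> pairwise disjnt v \<and>
             (\<forall>u\<in>v. homeomorphic_map (subtopology E u) (subtopology Y T) q))"
    using x N preimage_image_q[OF sub] act_image_open
    by (intro exI[of _ "q ` N"] conjI exI[of _ ?v]) auto
qed

text \<open>Fibres are orbits, so the action maps themselves are deck transformations that act
  transitively on each fibre.\<close>

lemma galois:
  assumes "connected_space E"
  shows "galois_covering E Y q"
  unfolding galois_covering_def
proof (intro conjI ballI impI)
  fix x x' assume x: "x \<in> topspace E" "x' \<in> topspace E" "q x = q x'"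
  then obtain g where g: "g \<in> carrier \<Gamma>" "x' = act g x" using fibre by blast
  have "homeomorphic_maps E E (act g) (act (inv g))"
    using g act_continuous act_inv by (auto simp: homeomorphic_maps_def)
  then show "\<exists>h. homeomorphic_map E E h \<and> (\<forall>z\<in>topspace E. q (h z) = q z) \<and> h x = x'"
    using g q_act homeomorphic_map_maps by blast
qed (use covering assms in auto)

text \<open>The connecting map sends a loop to the set of group elements carrying the base point to
  the end of the lifted path; this set is a coset of the stabiliser.\<close>

theorem fundamental_group_extension:
  assumes conn: "path_connected_space E" and e: "e \<in> topspace E"
  defines "N \<equiv> {g\<in>carrier \<Gamma>. act g e = e}"
  shows "\<exists>f g. short_exact (fundamental_group E e) (fundamental_group Y (q e)) (\<Gamma> Mod N) f g"
proof -
  note cont = covering_map_continuous[OF covering]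
  define lifts where "lifts = (\<lambda>\<gamma> \<delta>. pathin E \<delta> \<and> (\<forall>t\<in>{0..1}. q (\<delta> t) = \<gamma> t) \<and> \<delta> 0 = e)"
  define f where "f = (\<lambda>C. loop_class Y (q e) (q \<circ> (SOME g. g \<in> C)))"
  define K where "K = (\<lambda>\<gamma>. {g\<in>carrier \<Gamma>. \<exists>\<delta>. lifts \<gamma> \<delta> \<and> act g e = \<delta> 1})"
  define \<phi> where "\<phi> = (\<lambda>C. K (SOME \<gamma>. \<gamma> \<in> C))"
  let ?\<pi>E = "fundamental_group E e" and ?\<pi>Y = "fundamental_group Y (q e)"
  have lifts_ex: "\<exists>\<delta>. lifts \<gamma> \<delta>" if "\<gamma> \<in> loops_at Y (q e)" for \<gamma>
  proof -
    have "pathin Y \<gamma>" "q e = \<gamma> 0" using that by (auto simp: loops_at_def)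
    then obtain \<delta> where "pathin E \<delta>" "\<And>t. t \<in> {0..1} \<Longrightarrow> q (\<delta> t) = \<gamma> t" "\<delta> 0 = e"
      using covering_path_lift[OF covering _ e] by blast
    then show ?thesis unfolding lifts_def by blast
  qed
  have lifts_end: "\<delta> 1 = \<delta>' 1" if "loop_homotopic Y (q e) \<gamma> \<gamma>'" "lifts \<gamma> \<delta>" "lifts \<gamma>' \<delta>'" for \<gamma> \<gamma>' \<delta> \<delta>'
    using covering_homotopy_lift(1)[OF covering that(1)] that(2,3) unfolding lifts_def by blast
  have K_eq: "K \<gamma> = {g\<in>carrier \<Gamma>. act g e = \<delta> 1}" if "\<gamma> \<in> loops_at Y (q e)" "lifts \<gamma> \<delta>" for \<gamma> \<delta>
  proof -
    have "\<delta>' 1 = \<delta> 1" if "lifts \<gamma> \<delta>'" for \<delta>'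
      using lifts_end[OF loop_homotopic_refl] \<open>\<gamma> \<in> loops_at Y (q e)\<close> that \<open>lifts \<gamma> \<delta>\<close> by blast
    then have "(\<exists>\<delta>'. lifts \<gamma> \<delta>' \<and> act g e = \<delta>' 1) \<longleftrightarrow> act g e = \<delta> 1" for g
      using \<open>lifts \<gamma> \<delta>\<close> by metis
    then show ?thesis unfolding K_def by simp
  qed
  have end_act: "\<exists>g\<in>carrier \<Gamma>. act g e = \<delta> 1" if "\<gamma> \<in> loops_at Y (q e)" "lifts \<gamma> \<delta>" for \<gamma> \<delta>
  proof -
    have "\<delta> 1 \<in> topspace E" using that(2) pathin_topspace[of E \<delta> 1] by (simp add: lifts_def)
    moreover have "q e = q (\<delta> 1)" using that by (auto simp: lifts_def loops_at_def)
    ultimately show ?thesis using fibre[OF e] by metis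
  qed
  have \<phi>_class: "\<phi> (loop_class Y (q e) \<gamma>) = {g\<in>carrier \<Gamma>. act g e = \<delta> 1}"
    if \<gamma>: "\<gamma> \<in> loops_at Y (q e)" and \<delta>: "lifts \<gamma> \<delta>" for \<gamma> \<delta>
  proof -
    note some = loop_class_some[OF \<gamma>]
    obtain \<delta>' where \<delta>': "lifts (SOME \<gamma>'. \<gamma>' \<in> loop_class Y (q e) \<gamma>) \<delta>'" using lifts_ex[OF some(1)] by blast
    show ?thesis unfolding \<phi>_def K_eq[OF some(1) \<delta>'] using lifts_end[OF some(2) \<delta> \<delta>'] by simp
  qed
  have f_class: "f (loop_class E e g) = loop_class Y (q e) (q \<circ> g)" if g: "g \<in> loops_at E e" for g
    unfolding f_def
    using loop_class_eq_iff[OF loops_at_compose[OF g cont] loops_at_compose[OF _ cont]]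
      loop_class_some[OF g] loop_homotopic_compose[OF _ cont] by blast
  have lifts_loop: "lifts (q \<circ> g) g" if "g \<in> loops_at E e" for g
    using that by (auto simp: lifts_def loops_at_def)
  \<comment> \<open>The elements with a given value at \<open>e\<close> form a left coset of the
    stabiliser. Since \<open>N\<close> acts trivially everywhere, this is also the right coset that
    \<open>Mod\<close> uses.\<close>
  have coset: "{h\<in>carrier \<Gamma>. act h e = act g e} = N #> g" if g: "g \<in> carrier \<Gamma>" for g
  proof (intro equalityI subsetI)
    fix h assume h: "h \<in> {h\<in>carrier \<Gamma>. act h e = act g e}"
    have "act (h \<otimes> inv g) (act g e) = act g e"
      using h g e act_in act_inv(1)[OF g e] by (simp add: act_mult)
    then have "act (h \<otimes> inv g) e = e" using act_free[of "h \<otimes> inv g" "act g e" e] act_in g h e by simp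
    then have "h \<otimes> inv g \<in> N" using h g by (simp add: N_def)
    moreover have "h = (h \<otimes> inv g) \<otimes> g" using h g by (simp add: m_assoc)
    ultimately show "h \<in> N #> g" unfolding r_coset_def by blast
  next
    fix h assume "h \<in> N #> g"
    then obtain n where n: "n \<in> carrier \<Gamma>" "act n e = e" "h = n \<otimes> g" unfolding r_coset_def N_def by blast
    then show "h \<in> {h\<in>carrier \<Gamma>. act h e = act g e}"
      using g e act_in act_free[OF n(1) e n(2), of "act g e"] by (simp add: act_mult)
  qed
  have f_hom: "f \<in> hom ?\<pi>E ?\<pi>Y"
  proof (rule homI)
    fix C assume "C \<in> carrier ?\<pi>E"
    then obtain c where c: "c \<in> loops_at E e" "C = loop_class E e c" by (auto simp: carrier_fundamental_group)
    then show "f C \<in> carrier ?\<pi>Y" using f_class loops_at_compose[OF _ cont] by (auto simp: carrier_fundamental_group)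
    fix D assume "D \<in> carrier ?\<pi>E"
    then obtain d where d: "d \<in> loops_at E e" "D = loop_class E e d" by (auto simp: carrier_fundamental_group)
    have "q \<circ> loop_join c d = loop_join (q \<circ> c) (q \<circ> d)" by (auto simp: loop_join_def)
    then show "f (C \<otimes>\<^bsub>?\<pi>E\<^esub> D) = f C \<otimes>\<^bsub>?\<pi>Y\<^esub> f D"
      using c d by (simp add: fundamental_group_mult f_class loop_join_in_loops loops_at_compose[OF _ cont])
  qed
  have f_inj: "inj_on f (carrier ?\<pi>E)"
  proof (rule inj_onI)
    fix C D assume "C \<in> carrier ?\<pi>E" "D \<in> carrier ?\<pi>E" and eq: "f C = f D"
    then obtain c d where c: "c \<in> loops_at E e" "C = loop_class E e c"
      and d: "d \<in> loops_at E e" "D = loop_class E e d" by (auto simp: carrier_fundamental_group)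
    have "loop_homotopic Y (q e) (q \<circ> c) (q \<circ> d)"
      using eq loop_class_eq_iff[OF loops_at_compose[OF c(1) cont] loops_at_compose[OF d(1) cont]] c d f_class by simp
    then have "loop_homotopic E e c d"
      using covering_homotopy_lift(2)[OF covering, of "q e" "q \<circ> c" "q \<circ> d" c e d] c(1) d(1)
      by (simp add: loops_at_def)
    then show "C = D" using loop_class_eq_iff[OF c(1) d(1)] c(2) d(2) by simp
  qed
  have \<phi>_hom: "\<phi> \<in> hom ?\<pi>Y (\<Gamma> Mod N)"
  proof (rule homI)
    fix C assume "C \<in> carrier ?\<pi>Y"
    then obtain c where c: "c \<in> loops_at Y (q e)" "C = loop_class Y (q e) c" by (auto simp: carrier_fundamental_group)
    obtain c' where c': "lifts c c'" using lifts_ex[OF c(1)] by blast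
    obtain g where g: "g \<in> carrier \<Gamma>" "act g e = c' 1" using end_act[OF c(1) c'] by blast
    have \<phi>C: "\<phi> C = {h\<in>carrier \<Gamma>. act h e = act g e}" using \<phi>_class[OF c(1) c'] c(2) g by simp
    then show "\<phi> C \<in> carrier (\<Gamma> Mod N)"
      using coset[OF g(1)] g(1) by (auto simp: FactGroup_def RCOSETS_def)
    fix D assume "D \<in> carrier ?\<pi>Y"
    then obtain d where d: "d \<in> loops_at Y (q e)" "D = loop_class Y (q e) d" by (auto simp: carrier_fundamental_group)
    obtain d' where d': "lifts d d'" using lifts_ex[OF d(1)] by blast
    obtain h where h: "h \<in> carrier \<Gamma>" "act h e = d' 1" using end_act[OF d(1) d'] by blast
    have \<phi>D: "\<phi> D = {k\<in>carrier \<Gamma>. act k e = act h e}" using \<phi>_class[OF d(1) d'] d(2) h by simp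
    have d'E: "d' t \<in> topspace E" if "t \<in> {0..1}" for t using d' that pathin_topspace by (auto simp: lifts_def)
    \<comment> \<open>The lift of the second loop starts at \<open>e\<close>; translated by
      \<open>g\<close> it starts at the end of the first lift, so the joined lift ends at the image
      of \<open>e\<close> under g h. This order of factors makes \<phi> a homomorphism.\<close>
    have "pathin E (act g \<circ> d')"
      using d' act_continuous[OF g(1)] by (auto simp: lifts_def pathin_compose)
    then have "pathin E (loop_join c' (act g \<circ> d'))"
      using c' d' g by (intro pathin_loop_join) (auto simp: lifts_def)
    then have "lifts (loop_join c d) (loop_join c' (act g \<circ> d'))"
      using c' d' d'E q_act[OF g(1)] by (auto simp: lifts_def loop_join_def)
    then have "\<phi> (C \<otimes>\<^bsub>?\<pi>Y\<^esub> D) = {k\<in>carrier \<Gamma>. act k e = loop_join c' (act g \<circ> d') 1}"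
      using \<phi>_class[OF loop_join_in_loops[OF c(1) d(1)]] c d by (simp add: fundamental_group_mult)
    also have "\<dots> = {k\<in>carrier \<Gamma>. act k e = act (g \<otimes> h) e}"
      using g h e by (simp add: loop_join_ends act_mult)
    also have "\<dots> = \<phi> C <#> \<phi> D"
    proof (intro equalityI subsetI)
      fix k assume k: "k \<in> {k\<in>carrier \<Gamma>. act k e = act (g \<otimes> h) e}"
      have "act (inv g \<otimes> k) e = act h e"
        using k g(1) h(1) e act_in act_inv(1)[OF g(1), of "act h e"] by (simp add: act_mult)
      then have "inv g \<otimes> k \<in> \<phi> D" using k g(1) unfolding \<phi>D by simp
      moreover have "g \<in> \<phi> C" using g(1) unfolding \<phi>C by simp
      moreover have "k = g \<otimes> (inv g \<otimes> k)" using k g(1) by (simp flip: m_assoc)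
      ultimately show "k \<in> \<phi> C <#> \<phi> D" unfolding set_mult_def by blast
    next
      fix k assume "k \<in> \<phi> C <#> \<phi> D"
      then obtain a b where ab: "a \<in> carrier \<Gamma>" "act a e = act g e" "b \<in> carrier \<Gamma>" "act b e = act h e" "k = a \<otimes> b"
        unfolding set_mult_def \<phi>C \<phi>D by blast
      have "act (inv g \<otimes> a) e = e" using ab g(1) e act_inv(1)[OF g(1) e] by (simp add: act_mult)
      then have "act (inv g \<otimes> a) (act h e) = act h e"
        using act_free[of "inv g \<otimes> a" e "act h e"] ab g(1) h(1) e act_in by simp
      then have "act g (act (inv g \<otimes> a) (act h e)) = act g (act h e)" by simp
      then have "act a (act h e) = act g (act h e)"
        using ab g(1) h(1) e act_in act_inv(2)[OF g(1), of "act a (act h e)"] by (simp add: act_mult)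
      then show "k \<in> {k\<in>carrier \<Gamma>. act k e = act (g \<otimes> h) e}" using ab g(1) h(1) e by (simp add: act_mult)
    qed
    finally show "\<phi> (C \<otimes>\<^bsub>?\<pi>Y\<^esub> D) = \<phi> C \<otimes>\<^bsub>\<Gamma> Mod N\<^esub> \<phi> D"
      by (simp add: FactGroup_def)
  qed
  have \<phi>_surj: "\<phi> ` carrier ?\<pi>Y = carrier (\<Gamma> Mod N)"
  proof
    show "\<phi> ` carrier ?\<pi>Y \<subseteq> carrier (\<Gamma> Mod N)" using \<phi>_hom by (auto simp: hom_def)
    show "carrier (\<Gamma> Mod N) \<subseteq> \<phi> ` carrier ?\<pi>Y"
    proof
      fix S assume "S \<in> carrier (\<Gamma> Mod N)"
      then obtain g where g: "g \<in> carrier \<Gamma>" "S = N #> g" by (auto simp: FactGroup_def RCOSETS_def)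
      \<comment> \<open>Path connectedness realises every coset: a path from \<open>e\<close> to its
        translate projects to a loop.\<close>
      obtain \<delta> where \<delta>: "pathin E \<delta>" "\<delta> 0 = e" "\<delta> 1 = act g e"
        using conn e act_in[OF g(1) e] unfolding path_connected_space_def by blast
      have loop: "q \<circ> \<delta> \<in> loops_at Y (q e)"
        using \<delta> pathin_compose[OF _ cont] q_act[OF g(1) e] by (auto simp: loops_at_def)
      have "lifts (q \<circ> \<delta>) \<delta>" using \<delta> by (auto simp: lifts_def)
      then have "\<phi> (loop_class Y (q e) (q \<circ> \<delta>)) = S"
        using \<phi>_class[OF loop] coset[OF g(1)] g(2) \<delta>(3) by simp
      then show "S \<in> \<phi> ` carrier ?\<pi>Y" using loop by (auto simp: carrier_fundamental_group)
    qed
  qed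
  have exact: "f ` carrier ?\<pi>E = kernel ?\<pi>Y (\<Gamma> Mod N) \<phi>"
  proof
    show "f ` carrier ?\<pi>E \<subseteq> kernel ?\<pi>Y (\<Gamma> Mod N) \<phi>"
    proof
      fix D assume "D \<in> f ` carrier ?\<pi>E"
      then obtain c where c: "c \<in> loops_at E e" "D = loop_class Y (q e) (q \<circ> c)"
        using f_class by (auto simp: carrier_fundamental_group)
      have "\<phi> D = N"
        using \<phi>_class[OF loops_at_compose[OF c(1) cont] lifts_loop[OF c(1)]] c by (simp add: N_def loops_at_def)
      then show "D \<in> kernel ?\<pi>Y (\<Gamma> Mod N) \<phi>"
        using c loops_at_compose[OF c(1) cont] by (auto simp: kernel_def FactGroup_def carrier_fundamental_group)
    qed
    show "kernel ?\<pi>Y (\<Gamma> Mod N) \<phi> \<subseteq> f ` carrier ?\<pi>E"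
    proof
      fix D assume "D \<in> kernel ?\<pi>Y (\<Gamma> Mod N) \<phi>"
      then obtain d where d: "d \<in> loops_at Y (q e)" "D = loop_class Y (q e) d" "\<phi> D = N"
        by (auto simp: kernel_def FactGroup_def carrier_fundamental_group)
      obtain \<delta> where \<delta>: "lifts d \<delta>" using lifts_ex[OF d(1)] by blast
      have "\<one> \<in> \<phi> D" using d(3) e act_one by (simp add: N_def)
      then have "\<delta> 1 = e" using \<phi>_class[OF d(1) \<delta>] d(2) e act_one by simp
      then have loop: "\<delta> \<in> loops_at E e" using \<delta> by (simp add: lifts_def loops_at_def)
      \<comment> \<open>The projected lift and \<open>d\<close> agree on the unit interval only and
        may differ elsewhere as functions; the constant homotopy of \<open>d\<close> connects them,
        since homotopies are compared on the interval.\<close>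
      have "loop_homotopic Y (q e) (q \<circ> \<delta>) d"
      proof -
        obtain H where "continuous_map (prod_topology (top_of_set {0..1::real}) (top_of_set {0..1::real})) Y H"
          "\<forall>t\<in>{0..1}. H (0, t) = d t \<and> H (1, t) = d t" "\<forall>s\<in>{0..1}. H (s, 0) = q e \<and> H (s, 1) = q e"
          using loop_homotopic_refl[OF d(1)] unfolding loop_homotopic_def by blast
        then show ?thesis using \<delta> unfolding loop_homotopic_def lifts_def by (intro exI[of _ H]) auto
      qed
      then have "f (loop_class E e \<delta>) = D"
        using f_class[OF loop] loop_class_eq_iff[OF loops_at_compose[OF loop cont] d(1)] d(2) by simp
      then show "D \<in> f ` carrier ?\<pi>E" using loop by (auto simp: carrier_fundamental_group)
    qed
  qed
  show ?thesis
    using f_hom f_inj \<phi>_hom \<phi>_surj exact unfolding short_exact_def by blast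
qed

end

section \<open>The space of irregular types\<close>

text \<open>Degrees are handled through vanishing conditions rather than through the maximum. The
  bound on \<open>i\<close> matters: when all values vanish, the default degree 0 is not below
  0.\<close>

lemma dgr_less_iff:
  assumes "i \<ge> 1"
  shows "dgr p A \<alpha> < i \<longleftrightarrow> (\<forall>j\<in>{1..p}. i \<le> j \<longrightarrow> \<alpha> (A j) = 0)"
proof (cases "\<exists>j\<in>{1..p}. \<alpha> (A j) \<noteq> 0")
  case True
  then have "dgr p A \<alpha> < i \<longleftrightarrow> (\<forall>j\<in>{j\<in>{1..p}. \<alpha> (A j) \<noteq> 0}. j < i)"
    unfolding dgr_def by (subst Max_less_iff[symmetric]) auto
  then show ?thesis using not_le by blast
qed (use assms in \<open>auto simp: dgr_def\<close>)

lemma dgr_le: "dgr p A \<alpha> \<le> p"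
  using dgr_less_iff[of "Suc p" p A \<alpha>] by auto

lemma dgr_nonzero:
  assumes "dgr p A \<alpha> = i" "i \<ge> 1"
  shows "\<alpha> (A i) \<noteq> 0"
proof
  assume "\<alpha> (A i) = 0"
  moreover have "\<alpha> (A j) = 0" if "j \<in> {1..p}" "Suc i \<le> j" for j
    using dgr_less_iff[of "Suc i" p A \<alpha>] assms that by auto
  ultimately have "\<alpha> (A j) = 0" if "j \<in> {1..p}" "i \<le> j" for j
    using that by (cases "i = j") auto
  then have "dgr p A \<alpha> < i" using assms(2) dgr_less_iff by blast
  then show False using assms by simp
qed

text \<open>Degrees lie between 0 and \<open>p\<close>, so the larger of two distinct degrees is a
  tested index and separates them.\<close>

lemma dgr_eqI:
  assumes "\<And>i. i \<in> {1..p} \<Longrightarrow> dgr p A \<alpha> < i \<longleftrightarrow> dgr p B \<beta> < i"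
  shows "dgr p A \<alpha> = dgr p B \<beta>"
proof (rule ccontr)
  assume "dgr p A \<alpha> \<noteq> dgr p B \<beta>"
  then consider "dgr p A \<alpha> < dgr p B \<beta>" | "dgr p B \<beta> < dgr p A \<alpha>" by linarith
  then show False
    using assms[of "dgr p B \<beta>"] assms[of "dgr p A \<alpha>"] dgr_le[of p A \<alpha>] dgr_le[of p B \<beta>]
    by cases auto
qed

lemma dgr_dact: "dgr p (dact p w X) \<alpha> = dgr p X (\<alpha> \<circ> w)"
  by (rule dgr_eqI) (auto simp: dgr_less_iff dact_def)

text \<open>For a root of degree d the factors of B demand vanishing in all slots above d,
  nonvanishing in slot d when d is positive, and nothing below: together this fixes the degree of
  the root at X.\<close>

lemma Bfull_iff:
  "X \<in> Bfull \<Phi> p A \<longleftrightarrow> X \<in> extensional {1..p} \<and> (\<forall>\<alpha>\<in>\<Phi>. dgr p X \<alpha> = dgr p A \<alpha>)"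
proof
  assume X: "X \<in> Bfull \<Phi> p A"
  then have XB: "X i \<in> Bsp \<Phi> p A i" if "i \<in> {1..p}" for i
    using that by (auto simp: Bfull_def)
  have "dgr p X \<alpha> = dgr p A \<alpha>" if \<alpha>: "\<alpha> \<in> \<Phi>" for \<alpha>
  proof (rule dgr_eqI)
    fix i assume i: "i \<in> {1..p}"
    show "dgr p X \<alpha> < i \<longleftrightarrow> dgr p A \<alpha> < i"
    proof
      assume *: "dgr p X \<alpha> < i"
      show "dgr p A \<alpha> < i"
      proof (rule ccontr)
        assume "\<not> dgr p A \<alpha> < i"
        then have "dgr p A \<alpha> \<in> {1..p}" "i \<le> dgr p A \<alpha>" using i dgr_le[of p A \<alpha>] by auto
        then show False
          using * dgr_less_iff[of i p X \<alpha>] XB[of "dgr p A \<alpha>"] \<alpha> i unfolding Bsp_def by auto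
      qed
    next
      assume "dgr p A \<alpha> < i"
      then show "dgr p X \<alpha> < i"
        using i \<alpha> XB by (subst dgr_less_iff) (auto simp: Bsp_def)
    qed
  qed
  then show "X \<in> extensional {1..p} \<and> (\<forall>\<alpha>\<in>\<Phi>. dgr p X \<alpha> = dgr p A \<alpha>)"
    using X by (auto simp: Bfull_def PiE_def)
next
  assume X: "X \<in> extensional {1..p} \<and> (\<forall>\<alpha>\<in>\<Phi>. dgr p X \<alpha> = dgr p A \<alpha>)"
  have "X i \<in> Bsp \<Phi> p A i" if i: "i \<in> {1..p}" for i
    unfolding Bsp_def
  proof (intro CollectI conjI ballI impI)
    fix \<alpha> assume \<alpha>: "\<alpha> \<in> \<Phi>"
    show "\<alpha> (X i) = 0" if "dgr p A \<alpha> < i"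
      using dgr_less_iff[of i p X \<alpha>] X \<alpha> i that by auto
    show "\<alpha> (X i) \<noteq> 0" if "dgr p A \<alpha> = i"
      using dgr_nonzero[of p X \<alpha> i] X \<alpha> i that by auto
  qed
  then show "X \<in> Bfull \<Phi> p A" using X by (auto simp: Bfull_def PiE_def)
qed

lemma topspace_Btop: "topspace (Btop \<Phi> p A) = Bfull \<Phi> p A"
  by (auto simp: Btop_def tp_top_def Bfull_def PiE_def)

lemma Hausdorff_Btop: "Hausdorff_space (Btop \<Phi> p A)"
  unfolding Btop_def tp_top_def
  by (intro Hausdorff_space_subtopology) (simp add: Hausdorff_space_product_topology)

lemma continuous_map_Btop:
  assumes "\<And>x. x \<in> topspace X \<Longrightarrow> f x \<in> Bfull \<Phi> p A"
    and "\<And>i. i \<in> {1..p} \<Longrightarrow> continuous_map X euclidean (\<lambda>x. f x i)"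
  shows "continuous_map X (Btop \<Phi> p A) f"
  unfolding Btop_def tp_top_def
proof (rule continuous_map_into_subtopology)
  show "continuous_map X (product_topology (\<lambda>i. euclidean) {1..p}) f"
    unfolding continuous_map_componentwise using assms by (auto simp: Bfull_iff)
qed (use assms in auto)

lemma dact_comp: "dact p (v \<circ> w) X = dact p v (dact p w X)"
  by (auto simp: dact_def)

lemma dact_id: "X \<in> extensional {1..p} \<Longrightarrow> dact p id X = X"
  by (auto simp: dact_def extensional_restrict)

section \<open>The flag stabiliser and its action on B\<close>

context root_datum
begin

text \<open>The coefficients A_j with j \<ge> i lie in U_i. If \<open>w\<close> maps U_i into
  itself, composing a root of h_i with \<open>w\<close> therefore still kills them, so it stays a
  root of h_i. Conversely, preserved degrees mean that composition with \<open>w\<close> respects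
  every \<Phi>_h_i, whose common kernel is U_i.\<close>

lemma Stab_U_iff: "w \<in> Stab_U \<Phi> cor p A \<longleftrightarrow> w \<in> W \<and> (\<forall>\<alpha>\<in>\<Phi>. dgr p A (\<alpha> \<circ> w) = dgr p A \<alpha>)"
proof
  assume "w \<in> Stab_U \<Phi> cor p A"
  then have w: "w \<in> W" and U: "\<And>i x. i \<in> {1..p} \<Longrightarrow> x \<in> Usp \<Phi> p A i \<Longrightarrow> w x \<in> Usp \<Phi> p A i"
    unfolding Stab_U_def by blast+
  obtain v where v: "w \<circ> v = id" using W_inverse[OF w] by blast
  have inj: "\<alpha> = \<beta>" if "\<alpha> \<circ> w = \<beta> \<circ> w" for \<alpha> \<beta> :: "complex^'n \<Rightarrow> complex"
  proof -
    have "\<alpha> \<circ> w \<circ> v = \<beta> \<circ> w \<circ> v" using that by simp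
    then show ?thesis by (simp add: comp_assoc v)
  qed
  have "dgr p A (\<alpha> \<circ> w) = dgr p A \<alpha>" if \<alpha>: "\<alpha> \<in> \<Phi>" for \<alpha>
  proof (rule dgr_eqI)
    fix i assume i: "i \<in> {1..p}"
    have "\<beta> \<circ> w \<in> Phi_h \<Phi> p A i" if \<beta>: "\<beta> \<in> Phi_h \<Phi> p A i" for \<beta>
    proof -
      have "\<beta> (w (A j)) = 0" if "j \<in> {1..p}" "i \<le> j" for j
      proof -
        have "A j \<in> Usp \<Phi> p A i"
          using i that by (auto simp: Usp_def Phi_h_def dgr_less_iff)
        then show ?thesis using U[OF i] \<beta> by (auto simp: Usp_def)
      qed
      then show ?thesis using i \<beta> W_root[OF w] by (auto simp: Phi_h_def dgr_less_iff)
    qed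
    \<comment> \<open>An injective self-map of a finite set is onto; this turns the one-sided
      inclusion into the equivalence that equality of degrees needs.\<close>
    then have "(\<lambda>\<beta>. \<beta> \<circ> w) ` Phi_h \<Phi> p A i = Phi_h \<Phi> p A i"
      using inj finite_roots by (intro endo_inj_surj) (auto simp: Phi_h_def inj_on_def)
    then have "\<alpha> \<in> Phi_h \<Phi> p A i \<longleftrightarrow> \<alpha> \<circ> w \<in> Phi_h \<Phi> p A i"
      using inj by blast
    then show "dgr p A (\<alpha> \<circ> w) < i \<longleftrightarrow> dgr p A \<alpha> < i"
      using \<alpha> W_root[OF w \<alpha>] by (simp add: Phi_h_def)
  qed
  then show "w \<in> W \<and> (\<forall>\<alpha>\<in>\<Phi>. dgr p A (\<alpha> \<circ> w) = dgr p A \<alpha>)" using w by blast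
next
  assume w: "w \<in> W \<and> (\<forall>\<alpha>\<in>\<Phi>. dgr p A (\<alpha> \<circ> w) = dgr p A \<alpha>)"
  have "w x \<in> Usp \<Phi> p A i" if "x \<in> Usp \<Phi> p A i" for x i
    unfolding Usp_def
  proof (intro CollectI ballI)
    fix \<alpha> assume "\<alpha> \<in> Phi_h \<Phi> p A i"
    then have "\<alpha> \<circ> w \<in> Phi_h \<Phi> p A i" using w W_root by (auto simp: Phi_h_def)
    then have "(\<alpha> \<circ> w) x = 0" using that unfolding Usp_def by blast
    then show "\<alpha> (w x) = 0" by simp
  qed
  then show "w \<in> Stab_U \<Phi> cor p A" using w by (auto simp: Stab_U_def)
qed

lemma dact_Bfull_iff:
  assumes "w \<in> W" "X \<in> Bfull \<Phi> p A"
  shows "dact p w X \<in> Bfull \<Phi> p A \<longleftrightarrow> w \<in> Stab_U \<Phi> cor p A"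
proof -
  have "dgr p X (\<alpha> \<circ> w) = dgr p A (\<alpha> \<circ> w)" if "\<alpha> \<in> \<Phi>" for \<alpha>
    using assms(2) W_root[OF assms(1) that] by (simp add: Bfull_iff)
  then show ?thesis
    using assms(1) by (auto simp: Bfull_iff[of "dact p w X"] dgr_dact Stab_U_iff) (simp add: dact_def)
qed

lemma group_Stab_U: "group ((weyl_grp \<Phi> cor)\<lparr>carrier := Stab_U \<Phi> cor p A\<rparr>)"
proof (rule groupI)
  fix w assume "w \<in> carrier ((weyl_grp \<Phi> cor)\<lparr>carrier := Stab_U \<Phi> cor p A\<rparr>)"
  then have w: "w \<in> W" "\<And>\<alpha>. \<alpha> \<in> \<Phi> \<Longrightarrow> dgr p A (\<alpha> \<circ> w) = dgr p A \<alpha>" by (auto simp: Stab_U_iff)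
  then obtain v where v: "v \<in> W" "v \<circ> w = id" using W_inverse by blast
  have "dgr p A (\<alpha> \<circ> v) = dgr p A \<alpha>" if "\<alpha> \<in> \<Phi>" for \<alpha>
    using w(2)[OF W_root[OF v(1) that]] v(2) by (simp add: comp_assoc)
  then have "v \<in> Stab_U \<Phi> cor p A" using v by (simp add: Stab_U_iff)
  then show "\<exists>y\<in>carrier ((weyl_grp \<Phi> cor)\<lparr>carrier := Stab_U \<Phi> cor p A\<rparr>).
      y \<otimes>\<^bsub>(weyl_grp \<Phi> cor)\<lparr>carrier := Stab_U \<Phi> cor p A\<rparr>\<^esub> w
      = \<one>\<^bsub>(weyl_grp \<Phi> cor)\<lparr>carrier := Stab_U \<Phi> cor p A\<rparr>\<^esub>"
    using v(2) by (auto simp: weyl_grp_def)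
next
  fix v w assume "v \<in> carrier ((weyl_grp \<Phi> cor)\<lparr>carrier := Stab_U \<Phi> cor p A\<rparr>)"
    "w \<in> carrier ((weyl_grp \<Phi> cor)\<lparr>carrier := Stab_U \<Phi> cor p A\<rparr>)"
  then have "v \<circ> w \<in> Stab_U \<Phi> cor p A"
    using weyl_group_comp W_root by (auto simp: Stab_U_iff simp flip: comp_assoc)
  then show "v \<otimes>\<^bsub>(weyl_grp \<Phi> cor)\<lparr>carrier := Stab_U \<Phi> cor p A\<rparr>\<^esub> w
      \<in> carrier ((weyl_grp \<Phi> cor)\<lparr>carrier := Stab_U \<Phi> cor p A\<rparr>)"
    by (simp add: weyl_grp_def)
qed (auto simp: weyl_grp_def Stab_U_iff weyl_id comp_assoc)

lemma Bfull_fixator: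
  assumes X: "X \<in> Bfull \<Phi> p A" and w: "w \<in> W" and eq: "dact p w X = X"
  shows "w \<in> weyl_group (Phi_h \<Phi> p A 1) cor"
proof -
  have "{\<alpha>\<in>\<Phi>. \<forall>x\<in>X ` {1..p}. \<alpha> x = 0} = {\<alpha>\<in>\<Phi>. dgr p X \<alpha> < 1}"
    unfolding dgr_less_iff[OF order_refl] by auto
  also have "\<dots> = Phi_h \<Phi> p A 1" using X by (auto simp: Phi_h_def Bfull_iff)
  finally have "{\<alpha>\<in>\<Phi>. \<forall>x\<in>X ` {1..p}. \<alpha> x = 0} = Phi_h \<Phi> p A 1" .
  moreover have "w x = x" if "x \<in> X ` {1..p}" for x
  proof -
    obtain i where "i \<in> {1..p}" "x = X i" using \<open>x \<in> X ` {1..p}\<close> by blast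
    then show ?thesis using fun_cong[OF eq, of i] by (simp add: dact_def)
  qed
  ultimately show ?thesis using pointwise_fixator[OF w, of "X ` {1..p}"] by simp
qed

lemma weyl_group_Phi_h_fixes:
  assumes w: "w \<in> weyl_group (Phi_h \<Phi> p A 1) cor" and X: "X \<in> Bfull \<Phi> p A"
  shows "dact p w X = X"
proof
  fix i
  show "dact p w X i = X i"
  proof (cases "i \<in> {1..p}")
    case True
    have "\<alpha> (X i) = 0" if "\<alpha> \<in> Phi_h \<Phi> p A 1" for \<alpha>
    proof -
      have "dgr p X \<alpha> < 1" using that X by (simp add: Phi_h_def Bfull_iff)
      then show ?thesis using True unfolding dgr_less_iff[OF order_refl] by auto
    qed
    then show ?thesis using weyl_group_fixes[OF w] True by (simp add: dact_def)
  qed (use X in \<open>auto simp: dact_def Bfull_iff extensional_def\<close>)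
qed

lemma path_connected_Btop: "path_connected_space (Btop \<Phi> p A)"
  unfolding path_connected_space_def topspace_Btop
proof (intro ballI)
  fix x y assume xB: "x \<in> Bfull \<Phi> p A" and yB: "y \<in> Bfull \<Phi> p A"
  then have x: "x i \<in> Bsp \<Phi> p A i" and y: "y i \<in> Bsp \<Phi> p A i" if "i \<in> {1..p}" for i
    using that by (auto simp: Bfull_def)
  define L where "L = (\<lambda>z. restrict (\<lambda>i. x i + z *s (y i - x i)) {1..p})"
  have \<alpha>L: "\<alpha> (L z i) = \<alpha> (x i) + z * (\<alpha> (y i) - \<alpha> (x i))" if "\<alpha> \<in> \<Phi>" "i \<in> {1..p}" for \<alpha> i z
    using clin_funD[OF root_clin[OF that(1)]] that(2) by (simp add: L_def right_diff_distrib)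
  \<comment> \<open>The vanishing conditions of B hold along the whole complex line, so only the
    nonvanishing ones can fail. Each is an affine function of z that is nonzero at z = 0, hence has
    at most one zero.\<close>
  define bad where "bad = {z. \<exists>\<alpha>\<in>\<Phi>. \<exists>i\<in>{1..p}. dgr p A \<alpha> = i \<and> \<alpha> (L z i) = 0}"
  have "bad \<subseteq> (\<lambda>(\<alpha>, i). - \<alpha> (x i) / (\<alpha> (y i) - \<alpha> (x i))) ` (\<Phi> \<times> {1..p})"
  proof
    fix z assume "z \<in> bad"
    then obtain \<alpha> i where i: "\<alpha> \<in> \<Phi>" "i \<in> {1..p}" "dgr p A \<alpha> = i" "\<alpha> (L z i) = 0" by (auto simp: bad_def)
    have nz: "\<alpha> (x i) \<noteq> 0" using x[OF i(2)] i by (simp add: Bsp_def)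
    have "\<alpha> (x i) + z * (\<alpha> (y i) - \<alpha> (x i)) = 0" using \<alpha>L[OF i(1,2)] i(4) by simp
    then have zero: "z * (\<alpha> (y i) - \<alpha> (x i)) = - \<alpha> (x i)"
      by (simp only: eq_neg_iff_add_eq_0 add.commute)
    then have "\<alpha> (y i) - \<alpha> (x i) \<noteq> 0" using nz by auto
    with zero have "z = - \<alpha> (x i) / (\<alpha> (y i) - \<alpha> (x i))" by (metis nonzero_eq_divide_eq)
    then show "z \<in> (\<lambda>(\<alpha>, i). - \<alpha> (x i) / (\<alpha> (y i) - \<alpha> (x i))) ` (\<Phi> \<times> {1..p})"
      using i by (intro image_eqI[of _ _ "(\<alpha>, i)"]) auto
  qed
  then have "countable bad"
    using finite_roots by (meson countable_finite finite_SigmaI finite_atLeastAtMost finite_imageI finite_subset)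
  \<comment> \<open>Here the complex parameter is essential: the plane stays path connected when
    countably many points are removed, unlike the real line.\<close>
  then have pc: "path_connected (- bad)"
    by (intro path_connected_complement_countable) simp_all
  have L_in: "L z \<in> Bfull \<Phi> p A" if "z \<notin> bad" for z
  proof -
    have "L z i \<in> Bsp \<Phi> p A i" if i: "i \<in> {1..p}" for i
      unfolding Bsp_def
    proof (intro CollectI conjI ballI impI)
      fix \<alpha> assume \<alpha>: "\<alpha> \<in> \<Phi>"
      show "\<alpha> (L z i) = 0" if "dgr p A \<alpha> < i"
      proof -
        have "\<alpha> (x i) = 0" "\<alpha> (y i) = 0"
          using x[OF i] y[OF i] \<alpha> that unfolding Bsp_def by blast+
        then show ?thesis using \<alpha>L[OF \<alpha> i, of z] by simp
      qed
      show "\<alpha> (L z i) \<noteq> 0" if "dgr p A \<alpha> = i"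
        using \<open>z \<notin> bad\<close> \<alpha> i that unfolding bad_def by blast
    qed
    then show ?thesis by (auto simp: Bfull_def L_def)
  qed
  have L01: "L 0 = x" "L 1 = y"
    using xB yB by (auto simp: L_def Bfull_def PiE_def extensional_restrict)
  have "\<alpha> (x i) \<noteq> 0 \<and> \<alpha> (y i) \<noteq> 0" if "\<alpha> \<in> \<Phi>" "i \<in> {1..p}" "dgr p A \<alpha> = i" for \<alpha> i
    using x[OF that(2)] y[OF that(2)] that unfolding Bsp_def by blast
  then have "0 \<notin> bad" "1 \<notin> bad"
    unfolding bad_def mem_Collect_eq L01 by blast+
  then obtain g where g: "path g" "path_image g \<subseteq> - bad" "pathstart g = 0" "pathfinish g = 1"
    using pc unfolding path_connected_def by (metis ComplI)
  have "pathin (Btop \<Phi> p A) (\<lambda>t. L (g t))"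
    unfolding pathin_def
  proof (rule continuous_map_Btop)
    fix t assume "t \<in> topspace (top_of_set {0..1::real})"
    then have "g t \<notin> bad" using g(2) unfolding path_image_def topspace_euclidean_subtopology by blast
    then show "L (g t) \<in> Bfull \<Phi> p A" by (rule L_in)
  next
    fix i assume i: "i \<in> {1..p}"
    have "continuous_on {0..1} g" using g(1) by (simp add: path_def)
    then have "continuous_on {0..1} (\<lambda>t. x i + g t *s (y i - x i))"
      by (intro continuous_intros continuous_on_vector_scalar_mult)
    then show "continuous_map (top_of_set {0..1}) euclidean (\<lambda>t. L (g t) i)"
      using i by (simp add: L_def)
  qed
  then show "\<exists>h. pathin (Btop \<Phi> p A) h \<and> h 0 = x \<and> h 1 = y"
    using g L01 by (intro exI[of _ "\<lambda>t. L (g t)"]) (auto simp: pathstart_def pathfinish_def)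
qed

lemma dact_continuous:
  assumes "w \<in> Stab_U \<Phi> cor p A"
  shows "continuous_map (Btop \<Phi> p A) (Btop \<Phi> p A) (dact p w)"
proof (rule continuous_map_Btop)
  have w: "w \<in> W" using assms by (simp add: Stab_U_iff)
  show "dact p w x \<in> Bfull \<Phi> p A" if "x \<in> topspace (Btop \<Phi> p A)" for x
    using that dact_Bfull_iff[OF w] assms by (simp add: topspace_Btop)
  fix i assume i: "i \<in> {1..p}"
  have "continuous_map (Btop \<Phi> p A) euclidean (\<lambda>x. x i)"
    unfolding Btop_def tp_top_def
    using continuous_map_product_projection[OF i, of "\<lambda>_. euclidean"]
    by (rule continuous_map_from_subtopology)
  then have "continuous_map (Btop \<Phi> p A) euclidean (w \<circ> (\<lambda>x. x i))"
    using W_continuous[OF w] by (intro continuous_map_compose) auto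
  then show "continuous_map (Btop \<Phi> p A) euclidean (\<lambda>x. dact p w x i)"
    using i by (simp add: dact_def comp_def)
qed

lemma worbit_eq_iff:
  assumes x: "x \<in> Bfull \<Phi> p A" and y: "y \<in> Bfull \<Phi> p A"
  shows "worbit W p x = worbit W p y \<longleftrightarrow> (\<exists>w\<in>Stab_U \<Phi> cor p A. y = dact p w x)"
proof
  assume eq: "worbit W p x = worbit W p y"
  have "y = dact p id y" using y dact_id by (metis Bfull_iff)
  then have "y \<in> worbit W p y" unfolding worbit_def using weyl_id by blast
  then have "y \<in> worbit W p x" using eq by simp
  then obtain w where w: "w \<in> W" "y = dact p w x" unfolding worbit_def by blast
  then have "w \<in> Stab_U \<Phi> cor p A" using dact_Bfull_iff[OF w(1) x] y by simp
  then show "\<exists>w\<in>Stab_U \<Phi> cor p A. y = dact p w x" using w by blast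
next
  assume "\<exists>w\<in>Stab_U \<Phi> cor p A. y = dact p w x"
  then obtain w where w: "w \<in> W" "y = dact p w x" by (auto simp: Stab_U_iff)
  obtain v where v: "v \<in> W" "v \<circ> w = id" using W_inverse[OF w(1)] by blast
  have "dact p u y \<in> worbit W p x" if "u \<in> W" for u
    using weyl_group_comp[OF that w(1)] w(2) unfolding worbit_def by (auto simp flip: dact_comp)
  moreover have "dact p u x \<in> worbit W p y" if "u \<in> W" for u
  proof -
    have "dact p u x = dact p (u \<circ> (v \<circ> w)) x" by (simp add: v)
    also have "\<dots> = dact p (u \<circ> v) y" by (simp only: w dact_comp comp_assoc)
    finally show ?thesis using weyl_group_comp[OF that v(1)] unfolding worbit_def by blast
  qed
  ultimately show "worbit W p x = worbit W p y" unfolding worbit_def by blast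
qed

lemma free_finite_action_Btop:
  "free_finite_action ((weyl_grp \<Phi> cor)\<lparr>carrier := Stab_U \<Phi> cor p A\<rparr>) (Btop \<Phi> p A)
     (quotient_top (Btop \<Phi> p A) (worbit W p)) (worbit W p) (dact p)"
proof -
  interpret group "(weyl_grp \<Phi> cor)\<lparr>carrier := Stab_U \<Phi> cor p A\<rparr>" by (rule group_Stab_U)
  show ?thesis
  proof (unfold_locales, unfold topspace_Btop)
    have "Stab_U \<Phi> cor p A \<subseteq> W" by (auto simp: Stab_U_def)
    then show "finite (carrier ((weyl_grp \<Phi> cor)\<lparr>carrier := Stab_U \<Phi> cor p A\<rparr>))"
      using finite_W finite_subset by auto
    fix w x z assume "w \<in> carrier ((weyl_grp \<Phi> cor)\<lparr>carrier := Stab_U \<Phi> cor p A\<rparr>)"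
      "x \<in> Bfull \<Phi> p A" "dact p w x = x" "z \<in> Bfull \<Phi> p A"
    then show "dact p w z = z"
      using Bfull_fixator[of x p A w] weyl_group_Phi_h_fixes[of w p A z] by (simp add: Stab_U_iff)
  qed (auto simp: Hausdorff_Btop dact_continuous quotient_map_quotient_top worbit_eq_iff
      weyl_grp_def dact_comp dact_id Bfull_iff[of _ \<Phi> p A])
qed

text \<open>The stabiliser does not depend on the point of B. At the base point it identifies the
  subgroup \<open>N\<close> of the general extension with W_h1.\<close>

lemma stabiliser_eq:
  assumes "X \<in> Bfull \<Phi> p A"
  shows "{w\<in>Stab_U \<Phi> cor p A. dact p w X = X} = weyl_group (Phi_h \<Phi> p A 1) cor"
proof (intro equalityI subsetI)
  fix w assume "w \<in> {w\<in>Stab_U \<Phi> cor p A. dact p w X = X}"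
  then show "w \<in> weyl_group (Phi_h \<Phi> p A 1) cor" using Bfull_fixator[OF assms] by (simp add: Stab_U_iff)
next
  fix w assume w: "w \<in> weyl_group (Phi_h \<Phi> p A 1) cor"
  then have "w \<in> W" using weyl_group_mono[of "Phi_h \<Phi> p A 1" \<Phi> cor] by (auto simp: Phi_h_def)
  then show "w \<in> {w\<in>Stab_U \<Phi> cor p A. dact p w X = X}"
    using weyl_group_Phi_h_fixes[OF w assms] dact_Bfull_iff[of w X p A] assms by simp
qed

end

theorem theorem2p12:
  fixes \<Phi> :: "(complex^'n \<Rightarrow> complex) set"
    and cor :: "(complex^'n \<Rightarrow> complex) \<Rightarrow> complex^'n"
    and p :: nat
    and A :: "nat \<Rightarrow> complex^'n"
  assumes "reduced_root_datum \<Phi> cor"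
    and "p \<ge> 1"
  defines "Q \<equiv> restrict A {1..p}"
    and "q \<equiv> worbit (weyl_group \<Phi> cor) p"
  shows "galois_covering (Btop \<Phi> p A) (quotient_top (Btop \<Phi> p A) q) q
       \<and> (\<exists>f g. short_exact (fundamental_group (Btop \<Phi> p A) Q)
                  (fundamental_group (quotient_top (Btop \<Phi> p A) q) (q Q))
                  (W_gh \<Phi> cor p A) f g)"
proof -
  interpret root_datum \<Phi> cor by unfold_locales (rule assms(1))
  interpret free_finite_action "(weyl_grp \<Phi> cor)\<lparr>carrier := Stab_U \<Phi> cor p A\<rparr>" "Btop \<Phi> p A"
    "quotient_top (Btop \<Phi> p A) q" q "dact p"
    unfolding q_def by (rule free_finite_action_Btop)
  \<comment> \<open>Degrees only see the slots 1 to \<open>p\<close>, so cutting \<open>A\<close>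
    down to an extensional tuple leaves them unchanged and puts the base point into B.\<close>
  have "dgr p Q \<alpha> = dgr p A \<alpha>" for \<alpha>
    by (rule dgr_eqI) (auto simp: dgr_less_iff Q_def)
  then have Q: "Q \<in> Bfull \<Phi> p A" by (simp add: Bfull_iff Q_def)
  have "galois_covering (Btop \<Phi> p A) (quotient_top (Btop \<Phi> p A) q) q"
    by (intro galois path_connected_imp_connected_space path_connected_Btop)
  \<comment> \<open>With the stabiliser of Q equal to W_h1, the quotient in the general extension is
    literally \<open>W_gh\<close>.\<close>
  moreover have "\<exists>f g. short_exact (fundamental_group (Btop \<Phi> p A) Q)
      (fundamental_group (quotient_top (Btop \<Phi> p A) q) (q Q)) (W_gh \<Phi> cor p A) f g"
    using fundamental_group_extension[OF path_connected_Btop, of Q] Q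
    by (simp add: W_gh_def topspace_Btop stabiliser_eq)
  ultimately show ?thesis by blast
qed

end
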